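(* Let $G$ be an acyclic finite quiver with $n\ge1$ vertices, labeled so that $V_G=\{1,\dots,n\}$ and every edge is of the form $j\to i$ with $i<j$. Then $$\omega_c(G)=\sum_{\sigma\in S_n}d_{n,k(\sigma)}\prod_{\varepsilon\in E_G}\beta_{\varepsilon,s_\sigma(\varepsilon)},\qquad d_{n,k}=\frac{(-1)^{n-1-k}}{n\binom{n-1}{k}}\quad(0\le k\le n-1).$$
   Context: All quivers are finite. A quiver $G=(V_G,E_G,\rho_G)$ consists of finite sets $V_G,E_G$ and a map $\rho_G:E_G\to V_G\times V_G$; $\rho_G(\varepsilon)=(u,v)$ means $\varepsilon$ is directed from $u$ to $v$, written $\varepsilon:u\to v$. Parallel edges, directed cycles and tadpoles (edges $u\to u$) are allowed in general. $G$ is connected if $V_G\neq\emptyset$ and its underlying undirected graph is connected; otherwise it is called disconnected. Acyclic means without directed cycles (a tadpole is a directed cycle). Fix a field $\Bbbk$ of characteristic zero. Each edge $\varepsilon$ carries a parameter $\beta_\varepsilon$; these are independent indeterminates, and graph functions of $G$ take values in $\Bbbk[\beta_\varepsilon:\varepsilon\in E_G]$. Edges surviving in a subquiver or contraction keep their parameters. Put $\beta_{\varepsilon,\pm}=(\beta_\varepsilon\pm1)/2$. A cut-subquiver $H\preceq G$ has vertex set $V_G$ and an arbitrary edge subset $E_H\subseteq E_G$. The contraction $G/H$ has as vertices the connected components of $H$ and as edges $E_G\setminus E_H$ with induced incidences (an edge with both endpoints in one component becomes a tadpole). The function $e$: let $E_{\mathrm{tad}}(G)$ be the set of tadpoles and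 $G_{\mathrm{pruned}}$ the quiver obtained by deleting all tadpoles. For tadpole-free $G$, $e_0(G)=|\operatorname{LE}(G)|/|V_G|!$ if $G$ is acyclic ($\operatorname{LE}(G)$ = set of linear extensions of the partial order on $V_G$ induced by the edges), and $e_0(G)=0$ otherwise. In general $e(G)=\bigl(\prod_{\varepsilon\in E_{\mathrm{tad}}(G)}(-\beta_{\varepsilon,-})\bigr)e_0(G_{\mathrm{pruned}})$. The function $\omega$ is the unique function on quivers with $\sum_{H\preceq G}\omega(H)\,e(G/H)=\epsilon(G)$ for all $G$, where $\epsilon(G)=1$ if $E_G=\emptyset$ and $0$ otherwise. The connected function is $\omega_c(G)=\omega(G)$ if $G$ is connected and $\omega_c(G)=0$ otherwise. For $\sigma=(\sigma_1,\dots,\sigma_n)\in S_n$: $p_\sigma(i)=\sigma^{-1}(i)$ is the position of $i$ in the word $\sigma$; $k(\sigma)=\#\{a\in\{1,\dots,n-1\}:\sigma_a>\sigma_{a+1}\}$ is the number of descents; for an edge $\varepsilon:j\to i$ (with $i<j$), $s_\sigma(\varepsilon)=+$ if $p_\sigma(i)<p_\sigma(j)$ and $s_\sigma(\varepsilon)=-$ if $p_\sigma(i)>p_\sigma(j)$. *)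

theory Defs
  imports
    "Graph_Theory.Digraph_Component"
    "HOL-Library.Poly_Mapping"
    "HOL-Combinatorics.Permutations"
begin

section \<open>The polynomial ring\<close>

text \<open>
  Polynomials over \<open>'k\<close> in independent indeterminates \<open>\<beta>\<^sub>\<epsilon>\<close>, one for each \<open>\<epsilon> :: 'e\<close>. A monomial is
  a finitely supported exponent function \<open>'e \<Rightarrow>\<^sub>0 nat\<close>. All quivers whose edges have type \<open>'e\<close> share
  this ring, so an edge keeps its parameter in subquivers and contractions.
\<close>

type_synonym ('e, 'k) beta_poly = "('e \<Rightarrow>\<^sub>0 nat) \<Rightarrow>\<^sub>0 'k"

definition const :: "'k \<Rightarrow> ('e, 'k::field_char_0) beta_poly" where
  "const c = Poly_Mapping.single 0 c"

definition beta :: "'e \<Rightarrow> ('e, 'k::field_char_0) beta_poly" where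
  "beta \<epsilon> = Poly_Mapping.single (Poly_Mapping.single \<epsilon> 1) 1"

definition beta_plus :: "'e \<Rightarrow> ('e, 'k::field_char_0) beta_poly" where
  "beta_plus \<epsilon> = const (1 / 2) * (beta \<epsilon> + 1)"

definition beta_minus :: "'e \<Rightarrow> ('e, 'k::field_char_0) beta_poly" where
  "beta_minus \<epsilon> = const (1 / 2) * (beta \<epsilon> - 1)"


section \<open>Quivers\<close>

text \<open>
  A finite quiver is a \<^const>\<open>fin_digraph\<close>, which allows parallel arcs and loops; \<open>\<epsilon> : u \<rightarrow> v\<close> means
  \<open>tail G \<epsilon> = u\<close> and \<open>head G \<epsilon> = v\<close>. The cut-subquivers of \<open>G\<close> are its spanning subgraphs
  \<^term>\<open>{H. spanning H G}\<close>, and connectedness is \<^const>\<open>connected\<close>, which requires a vertex.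
\<close>

text \<open>A loop is a \<^const>\<open>pre_digraph.cycle\<close> of length one.\<close>

definition acyclic_quiver :: "('v, 'e) pre_digraph \<Rightarrow> bool" where
  "acyclic_quiver G \<longleftrightarrow> \<not> (\<exists>p. pre_digraph.cycle G p)"

text \<open>
  The vertex set of the connected component of \<open>v\<close>, as the strong component of \<open>v\<close> in the
  symmetrisation.
\<close>

definition component_of :: "('v, 'e) pre_digraph \<Rightarrow> 'v \<Rightarrow> 'v set" where
  "component_of H v = pre_digraph.scc_of (with_proj (mk_symmetric H)) v"

definition contract :: "('v, 'e) pre_digraph \<Rightarrow> ('v, 'e) pre_digraph \<Rightarrow> ('v set, 'e) pre_digraph" where
  "contract G H =
     \<lparr> verts = component_of H ` verts H,
       arcs = arcs G - arcs H,
       tail = (\<lambda>\<epsilon>. component_of H (tail G \<epsilon>)),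
       head = (\<lambda>\<epsilon>. component_of H (head G \<epsilon>)) \<rparr>"


section \<open>The functions \<open>e\<close>, \<open>\<omega>\<close> and \<open>\<omega>\<^sub>c\<close>\<close>

definition tadpoles :: "('v, 'e) pre_digraph \<Rightarrow> 'e set" where
  "tadpoles G = {\<epsilon> \<in> arcs G. tail G \<epsilon> = head G \<epsilon>}"

definition pruned :: "('v, 'e) pre_digraph \<Rightarrow> ('v, 'e) pre_digraph" where
  "pruned G = G\<lparr>arcs := arcs G - tadpoles G\<rparr>"

text \<open>
  An edge \<open>u \<rightarrow> v\<close> is read as \<open>v \<le> u\<close>, so that a labelling whose edges are all of the form \<open>j \<rightarrow> i\<close>
  with \<open>i < j\<close> is order preserving. The number of linear extensions does not depend on this choice.
\<close>

definition induced_order :: "('v, 'e) pre_digraph \<Rightarrow> 'v rel" where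
  "induced_order G = {(v, u). u \<rightarrow>\<^sup>*\<^bsub>G\<^esub> v}"

definition linear_extensions :: "('v, 'e) pre_digraph \<Rightarrow> 'v rel set" where
  "linear_extensions G = {R. linear_order_on (verts G) R \<and> induced_order G \<subseteq> R}"

definition e_zero :: "('v, 'e) pre_digraph \<Rightarrow> 'k::field_char_0" where
  "e_zero G =
     (if acyclic_quiver G then of_nat (card (linear_extensions G)) / fact (card (verts G)) else 0)"

definition e_fun :: "('v, 'e) pre_digraph \<Rightarrow> ('e, 'k::field_char_0) beta_poly" where
  "e_fun G = (\<Prod>\<epsilon>\<in>tadpoles G. - beta_minus \<epsilon>) * const (e_zero (pruned G))"

definition eps_fun :: "('v, 'e) pre_digraph \<Rightarrow> ('e, 'k::field_char_0) beta_poly" where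
  "eps_fun G = (if arcs G = {} then 1 else 0)"

text \<open>
  The values of \<open>w\<close> on records that are not finite quivers are fixed to be \<open>0\<close>, which makes the
  solution unique as a HOL function.
\<close>

definition omega_spec :: "(('v, 'e) pre_digraph \<Rightarrow> ('e, 'k::field_char_0) beta_poly) \<Rightarrow> bool" where
  "omega_spec w \<longleftrightarrow>
     (\<forall>G. fin_digraph G \<longrightarrow> (\<Sum>H | spanning H G. w H * e_fun (contract G H)) = eps_fun G) \<and>
     (\<forall>G. \<not> fin_digraph G \<longrightarrow> w G = 0)"

definition omega :: "('v, 'e) pre_digraph \<Rightarrow> ('e, 'k::field_char_0) beta_poly" where
  "omega = (THE w. omega_spec w)"

definition omega_c :: "('v, 'e) pre_digraph \<Rightarrow> ('e, 'k::field_char_0) beta_poly" where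
  "omega_c G = (if connected G then omega G else 0)"


section \<open>Permutations as words\<close>

text \<open>
  A permutation \<open>\<sigma>\<close> of \<open>{1..n}\<close> is the word \<open>\<sigma> 1, \<dots>, \<sigma> n\<close>; the position of the letter \<open>i\<close> is \<open>inv \<sigma> i\<close>.
\<close>

definition descents :: "nat \<Rightarrow> (nat \<Rightarrow> nat) \<Rightarrow> nat" where
  "descents n \<sigma> = card {a \<in> {1..n - 1}. \<sigma> a > \<sigma> (a + 1)}"

definition beta_sign :: "(nat, 'e) pre_digraph \<Rightarrow> (nat \<Rightarrow> nat) \<Rightarrow> 'e \<Rightarrow> ('e, 'k::field_char_0) beta_poly" where
  "beta_sign G \<sigma> \<epsilon> =
     (if inv \<sigma> (head G \<epsilon>) < inv \<sigma> (tail G \<epsilon>) then beta_plus \<epsilon> else beta_minus \<epsilon>)"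

definition d_coeff :: "nat \<Rightarrow> nat \<Rightarrow> 'k::field_char_0" where
  "d_coeff n k = (- 1) ^ (n - 1 - k) / (of_nat n * of_nat ((n - 1) choose k))"


section \<open>Existence and uniqueness of \<open>\<omega>\<close>\<close>

lemma linear_order_on_finite_has_top:
  assumes "finite A" "A \<noteq> {}" "linear_order_on A R"
  shows "\<exists>m\<in>A. \<forall>a\<in>A. (a, m) \<in> R"
  using assms
proof (induction A arbitrary: R rule: finite_ne_induct)
  case (singleton x)
  then show ?case by (auto simp: order_on_defs refl_on_def)
next
  case (insert x F)
  have "linear_order_on F (R \<inter> F \<times> F)"
    using insert.prems unfolding order_on_defs refl_on_def total_on_def trans_def antisym_def
    by blast
  then obtain m where m: "m \<in> F" "\<forall>a\<in>F. (a, m) \<in> R"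
    using insert.IH by blast
  have tr: "trans R" and "refl_on (insert x F) R" and "total_on (insert x F) R"
    using insert.prems by (simp_all add: order_on_defs)
  moreover have "x \<noteq> m" using m insert.hyps by auto
  ultimately have xx: "(x, x) \<in> R" and tot: "(x, m) \<in> R \<or> (m, x) \<in> R"
    using m(1) by (simp_all add: refl_on_def total_on_def)
  from tot show ?case
  proof
    assume "(x, m) \<in> R"
    then show ?thesis using m by auto
  next
    assume "(m, x) \<in> R"
    then have "\<forall>a\<in>insert x F. (a, x) \<in> R" using m xx transD[OF tr, of _ m x] by auto
    then show ?thesis by auto
  qed
qed

lemma linear_orders_decompose:
  assumes "finite A" "A \<noteq> {}"
  shows "{R. linear_order_on A R} =
    (\<Union>m\<in>A. (\<lambda>S. S \<union> A \<times> {m}) ` {S. linear_order_on (A - {m}) S})" (is "?L = ?R")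
proof (intro equalityI subsetI)
  fix R assume "R \<in> ?L"
  then have R: "linear_order_on A R" by simp
  obtain m where m: "m \<in> A" "\<forall>a\<in>A. (a, m) \<in> R"
    using linear_order_on_finite_has_top[OF assms R] by blast
  let ?S = "R \<inter> (A - {m}) \<times> (A - {m})"
  have "linear_order_on (A - {m}) ?S"
    using R unfolding order_on_defs refl_on_def total_on_def trans_def antisym_def by blast
  moreover have "R = ?S \<union> A \<times> {m}"
    using R m unfolding order_on_defs antisym_def by blast
  ultimately show "R \<in> ?R" using m(1) by blast
next
  fix R assume "R \<in> ?R"
  then obtain m S where m: "m \<in> A" and S: "linear_order_on (A - {m}) S" and R: "R = S \<union> A \<times> {m}"
    by blast
  have sub: "S \<subseteq> (A - {m}) \<times> (A - {m})" using S by (simp add: order_on_defs)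
  have "R \<subseteq> A \<times> A" using sub m R by blast
  moreover have "refl_on A R" using S m R unfolding order_on_defs refl_on_def by blast
  moreover have "trans R" using S sub R unfolding order_on_defs trans_def by blast
  moreover have "antisym R" using S sub R unfolding order_on_defs antisym_def by blast
  moreover have "total_on A R" using S m R unfolding order_on_defs total_on_def by blast
  ultimately show "R \<in> ?L" by (simp add: order_on_defs)
qed

lemma finite_linear_orders: "finite A \<Longrightarrow> finite {R. linear_order_on A R}"
  by (rule finite_subset[of _ "Pow (A \<times> A)"]) (auto simp: order_on_defs)

lemma card_linear_orders: "finite A \<Longrightarrow> card {R. linear_order_on A R} = fact (card A)"
proof (induction "card A" arbitrary: A)
  case 0
  then have "A = {}" by simp
  then have "{R. linear_order_on A R} = {{}}"
    by (auto simp: order_on_defs refl_on_def trans_def antisym_def total_on_def)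
  then show ?case using 0 by simp
next
  case (Suc n)
  then have ne: "A \<noteq> {}" by auto
  let ?F = "\<lambda>m. (\<lambda>S. S \<union> A \<times> {m}) ` {S. linear_order_on (A - {m}) S}"
  have cF: "card (?F m) = fact n" if m: "m \<in> A" for m
  proof -
    have "inj_on (\<lambda>S. S \<union> A \<times> {m}) {S. linear_order_on (A - {m}) S}"
    proof (rule inj_onI)
      fix S T assume ST: "S \<in> {S. linear_order_on (A - {m}) S}" "T \<in> {S. linear_order_on (A - {m}) S}"
        and eq: "S \<union> A \<times> {m} = T \<union> A \<times> {m}"
      have "S \<subseteq> (A - {m}) \<times> (A - {m})" "T \<subseteq> (A - {m}) \<times> (A - {m})"
        using ST by (auto simp: order_on_defs)
      then have "S = (S \<union> A \<times> {m}) - A \<times> {m}" "T = (T \<union> A \<times> {m}) - A \<times> {m}"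
        by blast+
      then show "S = T" using eq by simp
    qed
    then have "card (?F m) = card {S. linear_order_on (A - {m}) S}"
      by (rule card_image)
    also have "\<dots> = fact (card (A - {m}))"
      using Suc.hyps(2) Suc.prems m by (intro Suc.hyps(1)) auto
    finally show ?thesis using Suc.hyps(2)[symmetric] Suc.prems m by simp
  qed
  have "card {R. linear_order_on A R} = (\<Sum>m\<in>A. card (?F m))"
    unfolding linear_orders_decompose[OF Suc.prems ne]
  proof (rule card_UN_disjoint)
    show "\<forall>m\<in>A. finite (?F m)" using Suc.prems finite_linear_orders by auto
    show "\<forall>m\<in>A. \<forall>l\<in>A. m \<noteq> l \<longrightarrow> ?F m \<inter> ?F l = {}"
    proof (intro ballI impI)
      fix m l assume ml: "m \<in> A" "l \<in> A" "m \<noteq> l"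
      show "?F m \<inter> ?F l = {}"
      proof (rule ccontr)
        assume "?F m \<inter> ?F l \<noteq> {}"
        then obtain R where Rm: "R \<in> ?F m" and Rl: "R \<in> ?F l" by blast
        have "R \<in> {R. linear_order_on A R}"
          unfolding linear_orders_decompose[OF Suc.prems ne] using Rm ml by blast
        then have "antisym R" by (simp add: order_on_defs)
        moreover have "(l, m) \<in> R" using Rm ml by blast
        moreover have "(m, l) \<in> R" using Rl ml by blast
        ultimately show False using ml by (simp add: antisym_def)
      qed
    qed
  qed (use Suc.prems in auto)
  also have "\<dots> = card A * fact n" using cF by simp
  also have "\<dots> = fact (card A)" using Suc.hyps(2)[symmetric] by simp
  finally show ?case .
qed

lemma no_cycle_of_no_arcs: "arcs G = {} \<Longrightarrow> acyclic_quiver G"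
  unfolding acyclic_quiver_def pre_digraph.cycle_def pre_digraph.awalk_def by auto

lemma linear_extensions_no_arcs:
  assumes "arcs G = {}"
  shows "linear_extensions G = {R. linear_order_on (verts G) R}"
proof -
  have "induced_order G \<subseteq> {(v, v) | v. v \<in> verts G}"
  proof
    fix x assume "x \<in> induced_order G"
    then obtain u v where x: "x = (v, u)" and r: "u \<rightarrow>\<^sup>*\<^bsub>G\<^esub> v" by (auto simp: induced_order_def)
    have "(u, v) \<in> (arcs_ends G)\<^sup>*" using r by (rule reachable_rtranclI)
    then have "u = v" using assms by (simp add: arcs_ends_def)
    then show "x \<in> {(v, v) | v. v \<in> verts G}" using x r by (auto elim: reachable_in_vertsE)
  qed
  then show ?thesis
    unfolding linear_extensions_def order_on_defs refl_on_def by fast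
qed

lemma e_fun_no_arcs:
  fixes G :: "('v, 'e) pre_digraph"
  assumes "arcs G = {}" "finite (verts G)"
  shows "e_fun G = (1 :: ('e, 'k::field_char_0) beta_poly)"
proof -
  have t: "tadpoles G = {}" using assms by (simp add: tadpoles_def)
  then have p: "pruned G = G" by (simp add: pruned_def)
  have "e_zero G = (1 :: 'k)"
    using assms by (simp add: e_zero_def no_cycle_of_no_arcs linear_extensions_no_arcs
        card_linear_orders)
  then show ?thesis by (simp add: e_fun_def t p const_def)
qed

lemma e_fun_contract_self: "fin_digraph G \<Longrightarrow> e_fun (contract G G) = 1"
  by (rule e_fun_no_arcs) (auto simp: contract_def fin_digraph.finite_verts)

lemma spanning_self: "fin_digraph G \<Longrightarrow> spanning G G"
  by (simp add: spanning_def subgraph_def compatible_def fin_digraph_def)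

lemma spanning_fin_digraph:
  assumes "fin_digraph G" "spanning H G"
  shows "fin_digraph H"
proof -
  interpret G: fin_digraph G by fact
  have "wf_digraph H" "verts H = verts G" "arcs H \<subseteq> arcs G"
    using assms(2) by (auto simp: spanning_def subgraph_def)
  then show ?thesis
    by (metis G.finite_arcs G.finite_verts finite_subset wf_digraph.fin_digraphI)
qed

lemma spanning_eqI: "spanning H G \<Longrightarrow> arcs H = arcs G \<Longrightarrow> H = G"
  by (auto simp: spanning_def subgraph_def compatible_def)

lemma finite_spanning:
  assumes "fin_digraph G"
  shows "finite {H. spanning H G}"
proof -
  interpret fin_digraph G by fact
  have "inj_on arcs {H. spanning H G}"
    by (rule inj_onI) (auto simp: spanning_def subgraph_def compatible_def)
  moreover have "arcs ` {H. spanning H G} \<subseteq> Pow (arcs G)"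
    by (auto simp: spanning_def subgraph_def)
  ultimately show ?thesis
    by (meson finite_Pow_iff finite_arcs finite_imageD finite_subset)
qed

lemma card_arcs_proper_spanning:
  assumes "fin_digraph G" "spanning H G" "H \<noteq> G"
  shows "card (arcs H) < card (arcs G)"
proof -
  interpret fin_digraph G by fact
  have "arcs H \<subset> arcs G"
    using assms spanning_eqI[of H G] by (auto simp: spanning_def subgraph_def)
  then show ?thesis by (simp add: psubset_card_mono)
qed

lemma omega_sum_split:
  fixes w :: "('v, 'e) pre_digraph \<Rightarrow> ('e, 'k::field_char_0) beta_poly"
  assumes "fin_digraph G"
  shows "(\<Sum>H | spanning H G. w H * e_fun (contract G H)) =
         w G + (\<Sum>H | spanning H G \<and> H \<noteq> G. w H * e_fun (contract G H))"
proof -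
  have "{H. spanning H G} - {G} = {H. spanning H G \<and> H \<noteq> G}" by auto
  then show ?thesis
    using sum.remove[OF finite_spanning[OF assms], of G "\<lambda>H. w H * e_fun (contract G H)"]
    by (simp add: spanning_self assms e_fun_contract_self)
qed

function omega_rec :: "('v, 'e) pre_digraph \<Rightarrow> ('e, 'k::field_char_0) beta_poly" where
  "omega_rec G =
     (if fin_digraph G
      then eps_fun G - (\<Sum>H\<in>{H. spanning H G \<and> H \<noteq> G}. omega_rec H * e_fun (contract G H))
      else 0)"
  by auto
termination
  by (relation "Wellfounded.measure (\<lambda>G. card (arcs G))") (auto intro: card_arcs_proper_spanning)

declare omega_rec.simps [simp del]

lemma omega_spec_omega_rec: "omega_spec omega_rec"
  unfolding omega_spec_def
proof (intro conjI allI impI)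
  fix G :: "('v, 'e) pre_digraph" assume G: "fin_digraph G"
  show "(\<Sum>H | spanning H G. omega_rec H * e_fun (contract G H)) =
      (eps_fun G :: ('e, 'k::field_char_0) beta_poly)"
    unfolding omega_sum_split[OF G] by (subst omega_rec.simps) (simp add: G)
qed (subst omega_rec.simps, simp)

lemma omega_spec_unique:
  fixes w :: "('v, 'e) pre_digraph \<Rightarrow> ('e, 'k::field_char_0) beta_poly"
  assumes "omega_spec w" "omega_spec w'"
  shows "w = w'"
proof
  fix G :: "('v, 'e) pre_digraph"
  show "w G = w' G"
  proof (induction "card (arcs G)" arbitrary: G rule: less_induct)
    case less
    show ?case
    proof (cases "fin_digraph G")
      case True
      have "(\<Sum>H | spanning H G \<and> H \<noteq> G. w H * e_fun (contract G H)) =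
            (\<Sum>H | spanning H G \<and> H \<noteq> G. w' H * e_fun (contract G H))"
        using less card_arcs_proper_spanning[OF True] by (intro sum.cong) auto
      moreover have "(\<Sum>H | spanning H G. w H * e_fun (contract G H)) =
                     (\<Sum>H | spanning H G. w' H * e_fun (contract G H))"
        using assms True by (simp add: omega_spec_def)
      ultimately show ?thesis unfolding omega_sum_split[OF True] by simp
    next
      case False
      then show ?thesis using assms by (simp add: omega_spec_def)
    qed
  qed
qed

lemma omega_spec_ex1:
  "\<exists>!w :: ('v, 'e) pre_digraph \<Rightarrow> ('e, 'k::field_char_0) beta_poly. omega_spec w"
  using omega_spec_omega_rec omega_spec_unique by blast

lemma omega_spec_omega: "omega_spec omega"
  unfolding omega_def by (rule theI'[OF omega_spec_ex1])

end

theory Submission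
  imports
    Defs
    "HOL-Library.Disjoint_Sets"
    "HOL-Library.FuncSet"
    "HOL-Computational_Algebra.Polynomial"
begin

text \<open>
  For a finite quiver \<open>G\<close> let \<open>P\<^sub>G(N) = \<Sum>\<^sub>f \<Prod>\<^sub>\<epsilon> w\<^sub>\<epsilon>(f)\<close>, where \<open>f\<close> runs over all maps from the vertices to
  \<open>{0, \<dots>, N - 1}\<close> and \<open>w\<^sub>\<epsilon>(f)\<close> is \<open>\<beta>\<^bsub>\<epsilon>,+\<^esub>\<close> if \<open>f(head \<epsilon>) < f(tail \<epsilon>)\<close> and \<open>\<beta>\<^bsub>\<epsilon>,-\<^esub>\<close> otherwise. This is a
  polynomial in \<open>N\<close>, multiplicative over components and divisible by \<open>N\<^sup>c\<close>, where \<open>c\<close> is the number of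
  components. The claim is that \<open>\<omega>(G)\<close> is the coefficient of \<open>N\<^sup>c\<close> (\<open>omega_eq\<close>). Hence \<open>\<omega>\<^sub>c(G)\<close> is the
  linear coefficient of \<open>P\<^sub>G\<close> for every quiver with a vertex, because that coefficient vanishes when
  \<open>G\<close> is disconnected (\<open>omega_c_eq\<close>).

  For a labelled quiver, every \<open>f\<close> sorts the vertices into a word \<open>\<sigma>\<close>, equal values being listed in
  decreasing order of the labels. Then \<open>w\<^sub>\<epsilon>(f) = \<beta>\<^bsub>\<epsilon>,s(\<epsilon>)\<^esub>\<close> with the sign \<open>s(\<epsilon>)\<close> determined by \<open>\<sigma>\<close>, and
  \<open>(N + k(\<sigma>)) choose n\<close> maps give the word \<open>\<sigma>\<close>. The linear coefficient of this binomial is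
  \<open>d\<^bsub>n,k(\<sigma>)\<^esub>\<close>, which gives the formula (\<open>coeff_1_order_poly_labelled\<close>).

  To identify \<open>\<omega>\<close>, one checks the defining convolution identity for the lowest coefficients. Grouping
  the cut-subquivers by the partition \<open>P\<close> of the vertices into components, the factors \<open>-\<beta>\<^bsub>\<epsilon>,-\<^esub>\<close>
  of the loops of the contraction turn each \<open>w\<^sub>\<epsilon>\<close> inside a block into \<open>w\<^sub>\<epsilon> - \<beta>\<^bsub>\<epsilon>,-\<^esub>\<close>, which is \<open>1\<close> or
  \<open>0\<close> according to whether \<open>f(head \<epsilon>) < f(tail \<epsilon>)\<close>. All parameters disappear, and the identity becomes
  a statement on strict order polynomials: their coefficients of \<open>N\<close> to the number of vertices, which
  are the values of \<open>e\<^sub>0\<close>, and their lowest coefficients are inverse to each other under the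
  convolution over partitions (\<open>sum_order_volume_coeff\<close>). That follows from the decomposition of the strict maps into \<open>{0, \<dots>, N M - 1}\<close> by division with
  remainder (\<open>card_strict_maps_mult\<close>).
\<close>

section \<open>Strict maps and linear extensions\<close>

text \<open>
  The maps \<open>f : V \<rightarrow> {0, \<dots>, N - 1}\<close> with \<open>f a < f b\<close> for every pair \<open>(a, b)\<close> of \<open>R\<close>. They are
  \<open>undefined\<close> outside \<open>V\<close>, so that they can be counted. \<open>R\<close> need not be an order; if it has a
  cycle, there is no such map.
\<close>

definition strict_maps :: "'a set \<Rightarrow> 'a rel \<Rightarrow> nat \<Rightarrow> ('a \<Rightarrow> nat) set" where
  "strict_maps V R N = {f \<in> V \<rightarrow>\<^sub>E {..<N}. \<forall>(a, b)\<in>R. f a < f b}"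

text \<open>The linear orders on \<open>W\<close> that contain the relation \<open>Q\<close>.\<close>

definition lin_exts :: "'a set \<Rightarrow> 'a rel \<Rightarrow> 'a rel set" where
  "lin_exts W Q = {L. linear_order_on W L \<and> Q \<subseteq> L}"

lemma finite_strict_maps: "finite V \<Longrightarrow> finite (strict_maps V R N)"
  unfolding strict_maps_def by (rule finite_subset[OF Collect_restrict]) (auto intro: finite_PiE)

lemma sum_choose_lessThan: "(\<Sum>j<M. j choose k) = M choose Suc k"
  by (induction M) auto

lemma card_strict_maps_linear:
  assumes "finite W" "linear_order_on W L"
  shows "card (strict_maps W (L - Id) M) = M choose card W"
  using assms
proof (induction "card W" arbitrary: W L M)
  case 0
  then have "W = {}" "L = {}" by (auto simp: order_on_defs)
  then show ?case by (simp add: strict_maps_def)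
next
  case (Suc k)
  then have "W \<noteq> {}" by auto
  then obtain m where m: "m \<in> W" "\<forall>a\<in>W. (a, m) \<in> L"
    using linear_order_on_finite_has_top[OF Suc.prems(1) _ Suc.prems(2)] by blast
  define W' L' where "W' = W - {m}" and "L' = L \<inter> W' \<times> W'"
  have lin': "linear_order_on W' L'"
    using Suc.prems(2) unfolding W'_def L'_def order_on_defs refl_on_def total_on_def trans_def antisym_def by blast
  have cW': "card W' = k" "finite W'"
    using Suc.hyps(2) Suc.prems(1) m by (auto simp: W'_def)
  have L: "L - Id = (L' - Id) \<union> W' \<times> {m}"
    using Suc.prems(2) m unfolding W'_def L'_def order_on_defs antisym_def by blast
  have W: "W = insert m W'" "m \<notin> W'" using m by (auto simp: W'_def)
  have sub: "L' \<subseteq> W' \<times> W'" by (auto simp: L'_def)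
  \<comment> \<open>A strict map on a linear order is its value at the top \<open>m\<close> and a strict map below that value.\<close>
  have "bij_betw (\<lambda>f. (f m, restrict f W')) (strict_maps W (L - Id) M)
      (SIGMA j : {..<M}. strict_maps W' (L' - Id) j)"
  proof (rule bij_betw_byWitness[where f' = "\<lambda>(j, g). g(m := j)"])
    show "\<forall>f\<in>strict_maps W (L - Id) M. (\<lambda>(j, g). g(m := j)) (f m, restrict f W') = f"
      unfolding strict_maps_def W by (auto simp: fun_eq_iff PiE_def extensional_def)
    show "\<forall>x\<in>SIGMA j : {..<M}. strict_maps W' (L' - Id) j.
        (\<lambda>f. (f m, restrict f W')) ((\<lambda>(j, g). g(m := j)) x) = x"
      unfolding strict_maps_def using W(2) by (auto simp: fun_eq_iff PiE_def extensional_def)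
    show "(\<lambda>f. (f m, restrict f W')) ` strict_maps W (L - Id) M
        \<subseteq> (SIGMA j : {..<M}. strict_maps W' (L' - Id) j)"
    proof clarify
      fix f assume f: "f \<in> strict_maps W (L - Id) M"
      have lt: "f a < f b" if "(a, b) \<in> L' - Id \<or> a \<in> W' \<and> b = m" for a b
        using f that unfolding strict_maps_def L by auto
      have "f m < M" using f W(1) unfolding strict_maps_def by auto
      moreover have "restrict f W' \<in> strict_maps W' (L' - Id) (f m)"
        using lt sub unfolding strict_maps_def by auto
      ultimately show "f m \<in> {..<M} \<and> restrict f W' \<in> strict_maps W' (L' - Id) (f m)" by simp
    qed
    show "(\<lambda>(j, g). g(m := j)) ` (SIGMA j : {..<M}. strict_maps W' (L' - Id) j)
        \<subseteq> strict_maps W (L - Id) M"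
    proof
      fix h assume "h \<in> (\<lambda>(j, g). g(m := j)) ` (SIGMA j : {..<M}. strict_maps W' (L' - Id) j)"
      then obtain j g where j: "j \<in> {..<M}" and g: "g \<in> strict_maps W' (L' - Id) j"
        and h: "h = g(m := j)" by auto
      have gj: "g a < j" if "a \<in> W'" for a using g that unfolding strict_maps_def by auto
      have lt: "g a < g b" if "(a, b) \<in> L' - Id" for a b
        using g that unfolding strict_maps_def by auto
      have ext: "g a = undefined" if "a \<notin> W'" for a
        using g that unfolding strict_maps_def by auto
      have 1: "g(m := j) \<in> W \<rightarrow>\<^sub>E {..<M}"
        using j gj ext less_trans[OF gj] unfolding W(1) by (auto simp: PiE_def Pi_def extensional_def)
      have 2: "(g(m := j)) a < (g(m := j)) b" if "(a, b) \<in> L - Id" for a b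
        using that lt gj W(2) sub unfolding L by auto
      show "h \<in> strict_maps W (L - Id) M" using 1 2 unfolding h unfolding strict_maps_def by blast
    qed
  qed
  then have "card (strict_maps W (L - Id) M) = (\<Sum>j<M. card (strict_maps W' (L' - Id) j))"
    using finite_strict_maps[OF cW'(2)] by (simp add: bij_betw_same_card)
  also have "\<dots> = (\<Sum>j<M. j choose k)"
    using Suc.hyps(1)[OF cW'(1)[symmetric] cW'(2) lin'] cW'(1) by simp
  finally show ?case using sum_choose_lessThan Suc.hyps(2) by simp
qed

text \<open>
  Every injective map induces a linear order of its domain, so the injective strict maps are
  distributed over the linear extensions.
\<close>

lemma card_inj_strict_maps:
  assumes "finite W" "Q \<subseteq> W \<times> W" "Q \<inter> Id = {}"
  shows "card {g \<in> strict_maps W Q M. inj_on g W} = card (lin_exts W Q) * (M choose card W)"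
proof -
  have U: "{g \<in> strict_maps W Q M. inj_on g W} = (\<Union>L\<in>lin_exts W Q. strict_maps W (L - Id) M)"
  proof (intro equalityI subsetI)
    fix g assume g: "g \<in> {g \<in> strict_maps W Q M. inj_on g W}"
    define L where "L = {(a, b). a \<in> W \<and> b \<in> W \<and> g a \<le> g b}"
    have "linear_order_on W L"
      using g unfolding L_def order_on_defs refl_on_def total_on_def trans_def antisym_def inj_on_def
      by auto
    moreover have "Q \<subseteq> L" using g assms(2) unfolding L_def strict_maps_def by fastforce
    moreover have "g \<in> strict_maps W (L - Id) M"
      using g unfolding L_def strict_maps_def by (auto simp: inj_on_def le_less)
    ultimately show "g \<in> (\<Union>L\<in>lin_exts W Q. strict_maps W (L - Id) M)"
      unfolding lin_exts_def by blast
  next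
    fix g assume "g \<in> (\<Union>L\<in>lin_exts W Q. strict_maps W (L - Id) M)"
    then obtain L where L: "linear_order_on W L" "Q \<subseteq> L" and g: "g \<in> strict_maps W (L - Id) M"
      unfolding lin_exts_def by blast
    have "inj_on g W"
    proof (rule inj_onI, rule ccontr)
      fix a b assume ab: "a \<in> W" "b \<in> W" "g a = g b" "a \<noteq> b"
      then have "(a, b) \<in> L - Id \<or> (b, a) \<in> L - Id"
        using L(1) by (auto simp: order_on_defs total_on_def)
      moreover have "g c < g d" if "(c, d) \<in> L - Id" for c d
        using g that unfolding strict_maps_def by blast
      ultimately show False using ab(3) by (metis less_irrefl)
    qed
    then show "g \<in> {g \<in> strict_maps W Q M. inj_on g W}"
      using g L assms(3) unfolding strict_maps_def by blast
  qed
  have fin: "finite (lin_exts W Q)"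
    by (rule finite_subset[OF _ finite_linear_orders[OF assms(1)]]) (auto simp: lin_exts_def)
  have disj: "strict_maps W (L - Id) M \<inter> strict_maps W (L' - Id) M = {}"
    if LL: "linear_order_on W L" "linear_order_on W L'" "L \<noteq> L'" for L L'
  proof (rule ccontr)
    assume "strict_maps W (L - Id) M \<inter> strict_maps W (L' - Id) M \<noteq> {}"
    then obtain g where "g \<in> strict_maps W (L - Id) M" "g \<in> strict_maps W (L' - Id) M"
      by blast
    then have g: "\<forall>(a, b)\<in>L - Id. g a < g b" "\<forall>(a, b)\<in>L' - Id. g a < g b"
      unfolding strict_maps_def by simp_all
    have eq: "J = {(a, b). a \<in> W \<and> b \<in> W \<and> g a \<le> g b}"
      if J: "linear_order_on W J" "\<forall>(a, b)\<in>J - Id. g a < g b" for J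
    proof (intro equalityI subsetI)
      fix p assume pJ: "p \<in> J"
      moreover have "J \<subseteq> W \<times> W" using J(1) by (simp add: order_on_defs)
      ultimately obtain a b where p: "p = (a, b)" "a \<in> W" "b \<in> W" by blast
      have "g a \<le> g b" using J(2) pJ p(1) by (cases "a = b") (auto intro: less_imp_le)
      then show "p \<in> {(a, b). a \<in> W \<and> b \<in> W \<and> g a \<le> g b}" using p by simp
    next
      fix p assume "p \<in> {(a, b). a \<in> W \<and> b \<in> W \<and> g a \<le> g b}"
      then obtain a b where p: "p = (a, b)" and ab: "a \<in> W" "b \<in> W" "g a \<le> g b" by blast
      have "(a, b) \<in> J \<or> (b, a) \<in> J" 
        using J(1) ab(1,2) unfolding order_on_defs refl_on_def total_on_def by metis
      moreover have "(b, a) \<notin> J" if "a \<noteq> b"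
        using J(2) that ab(3) by (auto simp: not_less[symmetric])
      ultimately show "p \<in> J" using p by auto
    qed
    show False using eq[OF LL(1) g(1)] eq[OF LL(2) g(2)] LL(3) by simp
  qed
  have "card {g \<in> strict_maps W Q M. inj_on g W} = (\<Sum>L\<in>lin_exts W Q. card (strict_maps W (L - Id) M))"
    unfolding U using fin finite_strict_maps[OF assms(1)] disj
    by (intro card_UN_disjoint) (auto simp: lin_exts_def)
  also have "\<dots> = (\<Sum>L\<in>lin_exts W Q. M choose card W)"
    by (rule sum.cong) (auto simp: lin_exts_def card_strict_maps_linear assms(1))
  finally show ?thesis by simp
qed

section \<open>The lexicographic decomposition of strict maps\<close>

text \<open>The pairs of elements that lie in a common block of \<open>P\<close>.\<close>

definition internal :: "'a set set \<Rightarrow> 'a rel" where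
  "internal P = (\<Union>B\<in>P. B \<times> B)"

text \<open>
  The block of \<open>P\<close> containing \<open>v\<close>. The union runs over a single block when \<open>P\<close> is a partition
  of a set containing \<open>v\<close>.
\<close>

definition block :: "'a set set \<Rightarrow> 'a \<Rightarrow> 'a set" where
  "block P v = \<Union>{B \<in> P. v \<in> B}"

text \<open>
  The relation that \<open>R\<close> induces on the blocks of \<open>P\<close>; pairs inside a block, which would become
  loops, are dropped.
\<close>

definition quotient_rel :: "'a set set \<Rightarrow> 'a rel \<Rightarrow> 'a set rel" where
  "quotient_rel P R = (\<lambda>(a, b). (block P a, block P b)) ` (R - internal P)"

text \<open>The partition of \<open>V\<close> into the nonempty fibres of \<open>g\<close>.\<close>

definition fibres :: "'a set \<Rightarrow> ('a \<Rightarrow> 'b) \<Rightarrow> 'a set set" where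
  "fibres V g = (\<lambda>v. {u \<in> V. g u = g v}) ` V"

lemma block_eq: "partition_on V P \<Longrightarrow> B \<in> P \<Longrightarrow> v \<in> B \<Longrightarrow> block P v = B"
  unfolding block_def partition_on_def disjoint_def by blast

lemma block_in: "partition_on V P \<Longrightarrow> v \<in> V \<Longrightarrow> block P v \<in> P \<and> v \<in> block P v"
  by (metis UnionE block_eq partition_onD1)

lemma internal_iff: "partition_on V P \<Longrightarrow> u \<in> V \<Longrightarrow> v \<in> V \<Longrightarrow> (u, v) \<in> internal P \<longleftrightarrow> block P u = block P v"
  unfolding internal_def using block_eq[of V P] block_in[of V P] by blast

lemma partition_on_fibres: "partition_on V (fibres V g)"
  unfolding fibres_def partition_on_def disjoint_def by auto

lemma fibres_eq_iff:
  assumes "partition_on V P"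
  shows "fibres V g = P \<longleftrightarrow> (\<forall>u\<in>V. \<forall>v\<in>V. g u = g v \<longleftrightarrow> (u, v) \<in> internal P)"
proof
  assume "fibres V g = P"
  then show "\<forall>u\<in>V. \<forall>v\<in>V. g u = g v \<longleftrightarrow> (u, v) \<in> internal P"
    unfolding internal_def fibres_def by auto
next
  assume *: "\<forall>u\<in>V. \<forall>v\<in>V. g u = g v \<longleftrightarrow> (u, v) \<in> internal P"
  have "{u \<in> V. g u = g v} = block P v" if "v \<in> V" for v
  proof -
    have "block P v \<subseteq> V" using block_in[OF assms that] partition_onD1[OF assms] by blast
    then show ?thesis using * that internal_iff[OF assms] block_eq[OF assms] block_in[OF assms]
      by blast
  qed
  then have "fibres V g = block P ` V" unfolding fibres_def by simp
  also have "\<dots> = P"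
  proof (intro equalityI subsetI)
    fix B assume B: "B \<in> P"
    then obtain v where "v \<in> B" using partition_onD3[OF assms] by (metis ex_in_conv)
    moreover have "v \<in> V" using \<open>v \<in> B\<close> B partition_onD1[OF assms] by blast
    ultimately show "B \<in> block P ` V" using block_eq[OF assms B] by blast
  qed (use block_in[OF assms] in blast)
  finally show "fibres V g = P" .
qed

lemma less_div_mod_iff: "(x::nat) < y \<longleftrightarrow> x div N < y div N \<or> x div N = y div N \<and> x mod N < y mod N"
proof (cases "x div N" "y div N" rule: linorder_cases)
  case less
  then show ?thesis using div_le_mono[of y x N] by linarith
next
  case greater
  then show ?thesis using div_le_mono[of x y N] by linarith
next
  case equal
  have "x = y div N * N + x mod N" "y = y div N * N + y mod N"
    using div_mult_mod_eq[of x N] equal by simp_all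
  then have "x < y \<longleftrightarrow> x mod N < y mod N" by linarith
  then show ?thesis using equal by simp
qed

text \<open>
  The maps with fibres \<open>P\<close> correspond to the injective maps on the set of blocks; strictness on the
  pairs of \<open>R\<close> between different blocks becomes strictness for the induced relation.
\<close>

lemma bij_strict_maps_quotient:
  assumes P: "partition_on V P" and R: "R \<subseteq> V \<times> V"
  shows "bij_betw (\<lambda>h. \<lambda>v\<in>V. h (block P v)) {h \<in> strict_maps P (quotient_rel P R) M. inj_on h P}
    {g \<in> V \<rightarrow>\<^sub>E {..<M}. fibres V g = P \<and> (\<forall>(a, b)\<in>R - internal P. g a < g b)}"
proof -
  define rep where "rep B = (SOME v. v \<in> B)" for B :: "'a set"
  have rep: "rep B \<in> B" "rep B \<in> V" "block P (rep B) = B" if "B \<in> P" for B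
  proof -
    show 1: "rep B \<in> B" unfolding rep_def using that partition_onD3[OF P] by (metis some_in_eq)
    then show "rep B \<in> V" using that partition_onD1[OF P] by blast
    show "block P (rep B) = B" using block_eq[OF P that 1] .
  qed
  show ?thesis
  proof (rule bij_betw_byWitness[where f' = "\<lambda>g. \<lambda>B\<in>P. g (rep B)"])
    show "\<forall>h\<in>{h \<in> strict_maps P (quotient_rel P R) M. inj_on h P}.
       (\<lambda>B\<in>P. (\<lambda>v\<in>V. h (block P v)) (rep B)) = h"
      using rep by (auto simp: fun_eq_iff strict_maps_def PiE_def extensional_def)
    show "\<forall>g\<in>{g \<in> V \<rightarrow>\<^sub>E {..<M}. fibres V g = P \<and> (\<forall>(a, b)\<in>R - internal P. g a < g b)}.
       (\<lambda>v\<in>V. (\<lambda>B\<in>P. g (rep B)) (block P v)) = g"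
    proof
      fix g assume g: "g \<in> {g \<in> V \<rightarrow>\<^sub>E {..<M}. fibres V g = P \<and> (\<forall>(a, b)\<in>R - internal P. g a < g b)}"
      have "g (rep (block P v)) = g v" if "v \<in> V" for v
        using g fibres_eq_iff[OF P, of g] internal_iff[OF P] rep block_in[OF P that] that by simp
      then show "(\<lambda>v\<in>V. (\<lambda>B\<in>P. g (rep B)) (block P v)) = g"
        using g block_in[OF P] by (auto simp: fun_eq_iff PiE_def extensional_def)
    qed
    show "(\<lambda>h. \<lambda>v\<in>V. h (block P v)) ` {h \<in> strict_maps P (quotient_rel P R) M. inj_on h P} \<subseteq>
      {g \<in> V \<rightarrow>\<^sub>E {..<M}. fibres V g = P \<and> (\<forall>(a, b)\<in>R - internal P. g a < g b)}"
    proof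
      fix g assume "g \<in> (\<lambda>h. \<lambda>v\<in>V. h (block P v)) ` {h \<in> strict_maps P (quotient_rel P R) M. inj_on h P}"
      then obtain h where h: "h \<in> strict_maps P (quotient_rel P R) M" "inj_on h P"
        and g: "g = (\<lambda>v\<in>V. h (block P v))" by blast
      have "g \<in> V \<rightarrow>\<^sub>E {..<M}"
        using h(1) block_in[OF P] unfolding g strict_maps_def by auto
      moreover have "fibres V g = P"
        unfolding fibres_eq_iff[OF P]
        using inj_onD[OF h(2)] block_in[OF P] internal_iff[OF P] by (auto simp: g)
      moreover have "g a < g b" if "(a, b) \<in> R - internal P" for a b
      proof -
        have "(block P a, block P b) \<in> quotient_rel P R"
          unfolding quotient_rel_def using that by force
        then show ?thesis using h(1) that R unfolding g strict_maps_def by auto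
      qed
      ultimately show "g \<in> {g \<in> V \<rightarrow>\<^sub>E {..<M}. fibres V g = P \<and> (\<forall>(a, b)\<in>R - internal P. g a < g b)}"
        by auto
    qed
    show "(\<lambda>g. \<lambda>B\<in>P. g (rep B)) ` {g \<in> V \<rightarrow>\<^sub>E {..<M}. fibres V g = P \<and> (\<forall>(a, b)\<in>R - internal P. g a < g b)}
      \<subseteq> {h \<in> strict_maps P (quotient_rel P R) M. inj_on h P}"
    proof
      fix h assume "h \<in> (\<lambda>g. \<lambda>B\<in>P. g (rep B)) ` {g \<in> V \<rightarrow>\<^sub>E {..<M}. fibres V g = P \<and> (\<forall>(a, b)\<in>R - internal P. g a < g b)}"
      then obtain g where g: "g \<in> V \<rightarrow>\<^sub>E {..<M}" "fibres V g = P" "\<And>a b. (a, b) \<in> R - internal P \<Longrightarrow> g a < g b"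
        and h: "h = (\<lambda>B\<in>P. g (rep B))" by blast
      have geq: "g u = g v \<longleftrightarrow> block P u = block P v" if "u \<in> V" "v \<in> V" for u v
        using g(2) fibres_eq_iff[OF P, of g] internal_iff[OF P] that by simp
      have hb: "h (block P v) = g v" if "v \<in> V" for v
        using block_in[OF P that] geq[of "rep (block P v)" v] rep that by (simp add: h)
      have "h \<in> P \<rightarrow>\<^sub>E {..<M}" using g(1) rep unfolding h by auto
      moreover have "inj_on h P"
        using geq rep by (auto simp: inj_on_def h)
      moreover have "\<forall>(A, B)\<in>quotient_rel P R. h A < h B"
        using hb g(3) R unfolding quotient_rel_def by fastforce
      ultimately show "h \<in> {h \<in> strict_maps P (quotient_rel P R) M. inj_on h P}"
        unfolding strict_maps_def by auto
    qed
  qed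
qed

text \<open>
  Division with remainder by \<open>N\<close> turns a map into \<open>{0, \<dots>, N * M - 1}\<close> into a pair \<open>(g, f)\<close> of maps
  into \<open>{0, \<dots>, M - 1}\<close> and \<open>{0, \<dots>, N - 1}\<close>, compared lexicographically. Sorting by the fibres \<open>P\<close>
  of \<open>g\<close> separates the conditions: pairs inside a block constrain \<open>f\<close>, the others constrain \<open>g\<close>.
\<close>

lemma card_strict_maps_mult:
  assumes V: "finite V" and R: "R \<subseteq> V \<times> V" and N: "N > 0"
  shows "card (strict_maps V R (N * M)) =
    (\<Sum>P | partition_on V P. card (strict_maps V (R \<inter> internal P) N) *
       card {h \<in> strict_maps P (quotient_rel P R) M. inj_on h P})"
proof -
  define F where "F g = {f \<in> V \<rightarrow>\<^sub>E {..<N}. \<forall>(a, b)\<in>R. g a < g b \<or> g a = g b \<and> f a < f b}" for g :: "'a \<Rightarrow> nat"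
  have finPi: "finite (V \<rightarrow>\<^sub>E {..<K})" for K :: nat using V by (auto intro: finite_PiE)
  have "bij_betw (\<lambda>f. (\<lambda>v\<in>V. f v div N, \<lambda>v\<in>V. f v mod N)) (strict_maps V R (N * M))
     (Sigma (V \<rightarrow>\<^sub>E {..<M}) F)"
  proof (rule bij_betw_byWitness[where f' = "\<lambda>(g, f). \<lambda>v\<in>V. N * g v + f v"])
    show "\<forall>f\<in>strict_maps V R (N * M). (\<lambda>(g, f). \<lambda>v\<in>V. N * g v + f v) (\<lambda>v\<in>V. f v div N, \<lambda>v\<in>V. f v mod N) = f"
      by (auto simp: strict_maps_def fun_eq_iff PiE_def extensional_def)
    show "\<forall>p\<in>Sigma (V \<rightarrow>\<^sub>E {..<M}) F.
       (\<lambda>f. (\<lambda>v\<in>V. f v div N, \<lambda>v\<in>V. f v mod N)) ((\<lambda>(g, f). \<lambda>v\<in>V. N * g v + f v) p) = p"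
      using N by (auto simp: F_def fun_eq_iff PiE_def Pi_def extensional_def)
    show "(\<lambda>f. (\<lambda>v\<in>V. f v div N, \<lambda>v\<in>V. f v mod N)) ` strict_maps V R (N * M) \<subseteq> Sigma (V \<rightarrow>\<^sub>E {..<M}) F"
    proof clarify
      fix f assume f: "f \<in> strict_maps V R (N * M)"
      then have bd: "f v < N * M" if "v \<in> V" for v using that unfolding strict_maps_def by auto
      have "(\<lambda>v\<in>V. f v div N) \<in> V \<rightarrow>\<^sub>E {..<M}"
        using bd by (auto simp: less_mult_imp_div_less mult.commute)
      moreover have "(\<lambda>v\<in>V. f v mod N) \<in> V \<rightarrow>\<^sub>E {..<N}" using N by auto
      moreover have "(\<lambda>v\<in>V. f v div N) a < (\<lambda>v\<in>V. f v div N) b \<or>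
          (\<lambda>v\<in>V. f v div N) a = (\<lambda>v\<in>V. f v div N) b \<and> (\<lambda>v\<in>V. f v mod N) a < (\<lambda>v\<in>V. f v mod N) b"
        if "(a, b) \<in> R" for a b
      proof -
        have "a \<in> V" "b \<in> V" using R that by auto
        moreover have "f a < f b" using f that unfolding strict_maps_def by auto
        ultimately show ?thesis using less_div_mod_iff[of "f a" "f b" N] by simp
      qed
      ultimately show "(\<lambda>v\<in>V. f v div N) \<in> V \<rightarrow>\<^sub>E {..<M} \<and> (\<lambda>v\<in>V. f v mod N) \<in> F (\<lambda>v\<in>V. f v div N)"
        unfolding F_def by blast
    qed
    show "(\<lambda>(g, f). \<lambda>v\<in>V. N * g v + f v) ` Sigma (V \<rightarrow>\<^sub>E {..<M}) F \<subseteq> strict_maps V R (N * M)"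
    proof clarify
      fix g f assume g: "g \<in> V \<rightarrow>\<^sub>E {..<M}" and f: "f \<in> F g"
      have gb: "g v < M" and fb: "f v < N" if "v \<in> V" for v using that f g unfolding F_def by auto
      have "N * g v + f v < N * M" if "v \<in> V" for v
      proof -
        have "N * g v + f v < N * Suc (g v)" using fb[OF that] by simp
        also have "\<dots> \<le> N * M" using gb[OF that] by (intro mult_le_mono2) simp
        finally show ?thesis .
      qed
      moreover have "N * g a + f a < N * g b + f b" if "(a, b) \<in> R" for a b
      proof -
        have ab: "a \<in> V" "b \<in> V" using R that by auto
        have dm: "(N * g v + f v) div N = g v" "(N * g v + f v) mod N = f v" if "v \<in> V" for v
          using fb[OF that] N by simp_all
        have "g a < g b \<or> g a = g b \<and> f a < f b" using f that unfolding F_def by auto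
        then show ?thesis
          unfolding less_div_mod_iff[of "N * g a + f a" _ N] dm[OF ab(1)] dm[OF ab(2)] .
      qed
      ultimately show "(\<lambda>v\<in>V. N * g v + f v) \<in> strict_maps V R (N * M)"
        using R unfolding strict_maps_def by auto
    qed
  qed
  then have "card (strict_maps V R (N * M)) = (\<Sum>g\<in>V \<rightarrow>\<^sub>E {..<M}. card (F g))"
    using finPi by (simp add: bij_betw_same_card F_def)
  also have "\<dots> = (\<Sum>P | partition_on V P. \<Sum>g\<in>{g \<in> V \<rightarrow>\<^sub>E {..<M}. fibres V g = P}. card (F g))"
    by (rule sum.group[symmetric]) (use finPi finitely_many_partition_on[OF V] partition_on_fibres in auto)
  also have "\<dots> = (\<Sum>P | partition_on V P. card (strict_maps V (R \<inter> internal P) N) *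
       card {h \<in> strict_maps P (quotient_rel P R) M. inj_on h P})"
  proof (rule sum.cong[OF refl])
    fix P assume "P \<in> {P. partition_on V P}"
    then have P: "partition_on V P" by simp
    let ?S = "{g \<in> V \<rightarrow>\<^sub>E {..<M}. fibres V g = P}"
    let ?T = "{g \<in> V \<rightarrow>\<^sub>E {..<M}. fibres V g = P \<and> (\<forall>(a, b)\<in>R - internal P. g a < g b)}"
    have F: "F g = (if \<forall>(a, b)\<in>R - internal P. g a < g b then strict_maps V (R \<inter> internal P) N else {})"
      if "g \<in> ?S" for g
    proof -
      have "g a = g b \<longleftrightarrow> (a, b) \<in> internal P" if "(a, b) \<in> R" for a b
        using \<open>g \<in> ?S\<close> fibres_eq_iff[OF P, of g] that R by auto
      then have iff: "(g a < g b \<or> g a = g b \<and> f a < f b) \<longleftrightarrow>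
          (if (a, b) \<in> internal P then f a < f b else g a < g b)" if "(a, b) \<in> R" for a b f
        using that by (metis less_irrefl)
      have "F g = {f \<in> V \<rightarrow>\<^sub>E {..<N}. \<forall>(a, b)\<in>R. if (a, b) \<in> internal P then f a < f b else g a < g b}"
        unfolding F_def using iff by blast
      then show ?thesis unfolding strict_maps_def by (auto split: if_splits)
    qed
    have "(\<Sum>g\<in>?S. card (F g)) = (\<Sum>g\<in>?S. if \<forall>(a, b)\<in>R - internal P. g a < g b then card (strict_maps V (R \<inter> internal P) N) else 0)"
      by (rule sum.cong) (simp_all add: F)
    also have "\<dots> = (\<Sum>g\<in>?T. card (strict_maps V (R \<inter> internal P) N))"
      by (rule sum.mono_neutral_cong_right) (use finPi in auto)
    also have "\<dots> = card (strict_maps V (R \<inter> internal P) N) * card ?T" by simp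
    also have "card ?T = card {h \<in> strict_maps P (quotient_rel P R) M. inj_on h P}"
      using bij_betw_same_card[OF bij_strict_maps_quotient[OF P R]] by simp
    finally show "(\<Sum>g\<in>?S. card (F g)) = card (strict_maps V (R \<inter> internal P) N) *
       card {h \<in> strict_maps P (quotient_rel P R) M. inj_on h P}" .
  qed
  finally show ?thesis .
qed

section \<open>The strict order polynomial\<close>

lemma poly_eqI_nat:
  fixes p q :: "'k::field_char_0 poly"
  assumes "\<And>n. n > 0 \<Longrightarrow> poly p (of_nat n) = poly q (of_nat n)"
  shows "p = q"
proof (rule ccontr)
  assume "p \<noteq> q"
  then have "finite {x. poly (p - q) x = 0}" using poly_roots_finite[of "p - q"] by simp
  moreover have "of_nat ` {0<..} \<subseteq> {x. poly (p - q) x = 0}" using assms by auto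
  ultimately have "finite ((of_nat :: nat \<Rightarrow> 'k) ` {0<..})" by (rule rev_finite_subset)
  then have "finite ({0<..} :: nat set)" by (rule finite_imageD) (auto simp: inj_on_def)
  then show False by (simp add: infinite_Ioi)
qed

text \<open>The falling factorial \<open>x (x - 1) \<dots> (x - k + 1)\<close> as a polynomial.\<close>

definition falling :: "nat \<Rightarrow> 'k::field_char_0 poly" where
  "falling k = (\<Prod>i<k. [:- of_nat i, 1:])"

text \<open>
  The proportion of the linear orders on \<open>W\<close> that extend \<open>Q\<close>. For a relation \<open>Q\<close> on a finite set
  \<open>W\<close> this is the volume of the polytope in the cube \<open>[0, 1]\<^sup>W\<close> given by \<open>x\<^sub>a \<le> x\<^sub>b\<close> for \<open>(a, b) \<in> Q\<close>. It
  is \<open>0\<close> if \<open>Q\<close> has a cycle through two distinct elements.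
\<close>

definition order_volume :: "'a set \<Rightarrow> 'a rel \<Rightarrow> 'k::field_char_0" where
  "order_volume W Q = of_nat (card (lin_exts W Q)) / fact (card W)"

text \<open>
  The polynomial whose value at every natural number \<open>N\<close> is the number of strict maps into
  \<open>{0, \<dots>, N - 1}\<close>. Its existence, for \<open>R \<subseteq> V \<times> V\<close> with \<open>V\<close> finite, is shown in
  \<open>poly_order_poly\<close> below.
\<close>

definition order_poly :: "'a set \<Rightarrow> 'a rel \<Rightarrow> 'k::field_char_0 poly" where
  "order_poly V R = (THE p. \<forall>N. poly p (of_nat N) = of_nat (card (strict_maps V R N)))"

lemma poly_falling: "poly (falling k) x = (\<Prod>i<k. x - of_nat i)"
  by (simp add: falling_def poly_prod)

lemma of_nat_card_inj_strict_maps: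
  assumes "finite W" "Q \<subseteq> W \<times> W" "Q \<inter> Id = {}"
  shows "of_nat (card {g \<in> strict_maps W Q M. inj_on g W}) =
    (order_volume W Q * poly (falling (card W)) (of_nat M) :: 'k::field_char_0)"
proof -
  have "of_nat (M choose card W) = (poly (falling (card W)) (of_nat M) / fact (card W) :: 'k)"
    by (simp add: binomial_gbinomial gbinomial_prod_rev poly_falling atLeast0LessThan)
  then show ?thesis
    by (simp add: card_inj_strict_maps[OF assms] order_volume_def)
qed

lemma quotient_rel_subset:
  assumes "partition_on V P" "R \<subseteq> V \<times> V"
  shows "quotient_rel P R \<subseteq> P \<times> P" "quotient_rel P R \<inter> Id = {}"
proof -
  show "quotient_rel P R \<subseteq> P \<times> P"
    using assms block_in[OF assms(1)] unfolding quotient_rel_def by auto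
  show "quotient_rel P R \<inter> Id = {}"
    using assms internal_iff[OF assms(1)] unfolding quotient_rel_def by auto
qed

lemma strict_maps_one:
  assumes "R \<subseteq> V \<times> V"
  shows "card (strict_maps V R 1) = (if R = {} then 1 else 0)"
proof -
  have *: "V \<rightarrow>\<^sub>E {..<Suc 0} = {\<lambda>v\<in>V. 0}"
    by (auto simp: PiE_def Pi_def extensional_def fun_eq_iff)
  show ?thesis
  proof (cases "R = {}")
    case True
    then show ?thesis by (simp add: strict_maps_def *)
  next
    case False
    have "strict_maps V R 1 = {}"
    proof (rule ccontr)
      assume "strict_maps V R 1 \<noteq> {}"
      then obtain f where "f \<in> strict_maps V R 1" by blast
      then have f: "f \<in> V \<rightarrow>\<^sub>E {..<1}" "\<forall>(a, b)\<in>R. f a < f b"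
        unfolding strict_maps_def by simp_all
      obtain a b where ab: "(a, b) \<in> R" using False by auto
      then have "b \<in> V" using assms by auto
      then have "f b < 1" using f(1) by auto
      moreover have "f a < f b" using f(2) ab by auto
      ultimately show False by simp
    qed
    then show ?thesis using False by simp
  qed
qed

text \<open>
  The existence of the polynomial is the case \<open>N = 1\<close> of the lexicographic decomposition, which
  sorts the strict maps by their fibres.
\<close>

lemma poly_order_poly:
  assumes V: "finite V" and R: "R \<subseteq> V \<times> V"
  shows "poly (order_poly V R) (of_nat N) = (of_nat (card (strict_maps V R N)) :: 'k::field_char_0)"
proof -
  define p :: "'k poly" where "p = (\<Sum>P | partition_on V P.
    smult (of_nat (card (strict_maps V (R \<inter> internal P) 1)) * order_volume P (quotient_rel P R)) (falling (card P)))"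
  have p: "poly p (of_nat M) = of_nat (card (strict_maps V R M))" for M
  proof -
    have "of_nat (card (strict_maps V R (1 * M))) = poly p (of_nat M)"
      unfolding card_strict_maps_mult[OF V R zero_less_one] p_def poly_sum of_nat_sum
    proof (rule sum.cong[OF refl])
      fix P assume "P \<in> {P. partition_on V P}"
      then have P: "partition_on V P" by simp
      show "of_nat (card (strict_maps V (R \<inter> internal P) 1) *
          card {h \<in> strict_maps P (quotient_rel P R) M. inj_on h P}) =
        poly (smult (of_nat (card (strict_maps V (R \<inter> internal P) 1)) * order_volume P (quotient_rel P R))
           (falling (card P)) :: 'k poly) (of_nat M)"
        using of_nat_card_inj_strict_maps[OF finite_elements[OF V P] quotient_rel_subset[OF P R], of M, where 'k = 'k]
        by (simp add: mult.assoc)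
    qed
    then show ?thesis by simp
  qed
  have "order_poly V R = p"
    unfolding order_poly_def
    by (rule the_equality) (use p in \<open>auto intro!: poly_eqI_nat\<close>)
  then show ?thesis using p by simp
qed

lemma order_poly_eqI:
  fixes p :: "'k::field_char_0 poly"
  assumes "finite V" "R \<subseteq> V \<times> V" "\<And>N. N > 0 \<Longrightarrow> poly p (of_nat N) = of_nat (card (strict_maps V R N))"
  shows "order_poly V R = p"
  by (rule poly_eqI_nat) (simp add: poly_order_poly assms)

lemma order_poly_at_0:
  assumes "finite V" "V \<noteq> {}" "R \<subseteq> V \<times> V"
  shows "poly (order_poly V R) 0 = (0 :: 'k::field_char_0)"
proof -
  have "strict_maps V R 0 = {}" using assms(2) by (auto simp: strict_maps_def PiE_eq_empty_iff)
  then show ?thesis using poly_order_poly[OF assms(1,3), of 0, where 'k = 'k] by simp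
qed

lemma order_poly_at_1:
  assumes "finite V" "R \<subseteq> V \<times> V"
  shows "poly (order_poly V R) 1 = (if R = {} then 1 else 0 :: 'k::field_char_0)"
  using poly_order_poly[OF assms, of 1, where 'k = 'k] strict_maps_one[OF assms(2)] by simp

lemma card_strict_maps_Un:
  assumes "A \<inter> B = {}" "R \<subseteq> A \<times> A" "S \<subseteq> B \<times> B"
  shows "card (strict_maps (A \<union> B) (R \<union> S) N) = card (strict_maps A R N) * card (strict_maps B S N)"
proof -
  have "bij_betw (\<lambda>f. (restrict f A, restrict f B)) (strict_maps (A \<union> B) (R \<union> S) N)
    (strict_maps A R N \<times> strict_maps B S N)"
  proof (rule bij_betw_byWitness[where f' = "\<lambda>(f, g). \<lambda>x\<in>A \<union> B. if x \<in> A then f x else g x"])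
    show "\<forall>f\<in>strict_maps (A \<union> B) (R \<union> S) N.
       (\<lambda>(f, g). \<lambda>x\<in>A \<union> B. if x \<in> A then f x else g x) (restrict f A, restrict f B) = f"
      by (auto simp: strict_maps_def fun_eq_iff PiE_def extensional_def)
    show "\<forall>p\<in>strict_maps A R N \<times> strict_maps B S N.
       (\<lambda>f. (restrict f A, restrict f B)) ((\<lambda>(f, g). \<lambda>x\<in>A \<union> B. if x \<in> A then f x else g x) p) = p"
      using assms(1) by (auto simp: strict_maps_def fun_eq_iff PiE_def extensional_def)
    show "(\<lambda>f. (restrict f A, restrict f B)) ` strict_maps (A \<union> B) (R \<union> S) N
      \<subseteq> strict_maps A R N \<times> strict_maps B S N"
      using assms(2,3) by (fastforce simp: strict_maps_def)
    show "(\<lambda>(f, g). \<lambda>x\<in>A \<union> B. if x \<in> A then f x else g x) ` (strict_maps A R N \<times> strict_maps B S N)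
      \<subseteq> strict_maps (A \<union> B) (R \<union> S) N"
    proof clarify
      fix f g assume f: "f \<in> strict_maps A R N" and g: "g \<in> strict_maps B S N"
      let ?h = "\<lambda>x\<in>A \<union> B. if x \<in> A then f x else g x"
      have "?h \<in> A \<union> B \<rightarrow>\<^sub>E {..<N}" using f g by (auto simp: strict_maps_def)
      moreover have "?h a < ?h b" if "(a, b) \<in> R" for a b
        using f that assms(2) by (auto simp: strict_maps_def)
      moreover have "?h a < ?h b" if "(a, b) \<in> S" for a b
      proof -
        have "a \<in> B" "b \<in> B" "a \<notin> A" "b \<notin> A" using that assms(1,3) by auto
        then show ?thesis using g that by (auto simp: strict_maps_def)
      qed
      ultimately show "?h \<in> strict_maps (A \<union> B) (R \<union> S) N" unfolding strict_maps_def by blast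
    qed
  qed
  then show ?thesis by (simp add: bij_betw_same_card card_cartesian_product)
qed

lemma order_poly_Un:
  assumes "finite A" "finite B" "A \<inter> B = {}" "R \<subseteq> A \<times> A" "S \<subseteq> B \<times> B"
  shows "order_poly (A \<union> B) (R \<union> S) = (order_poly A R * order_poly B S :: 'k::field_char_0 poly)"
  by (rule order_poly_eqI)
    (use assms in \<open>auto simp: card_strict_maps_Un poly_order_poly\<close>)

text \<open>
  The order polynomial is multiplicative over blocks that are not related to each other, and the
  factor of each nonempty block vanishes at \<open>0\<close>.
\<close>

lemma monom_dvd_order_poly:
  assumes "finite V" "partition_on V P" "R \<subseteq> internal P"
  shows "monom 1 (card P) dvd (order_poly V R :: 'k::field_char_0 poly)"
proof -
  have "finite P" using assms finite_elements by blast
  then show ?thesis using assms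
  proof (induction P arbitrary: V R rule: finite_induct)
    case empty
    then show ?case by simp
  next
    case (insert B P)
    define V' R1 R2 where "V' = \<Union>P" and "R1 = R \<inter> B \<times> B" and "R2 = R \<inter> internal P"
    have BV': "V = B \<union> V'" "B \<inter> V' = {}" and B: "B \<noteq> {}" and part: "partition_on V' P"
      using insert.prems(2) insert.hyps unfolding V'_def partition_on_def disjoint_def by auto
    have fin: "finite B" "finite V'" using insert.prems(1) BV' by auto
    have R: "R = R1 \<union> R2" "R1 \<subseteq> B \<times> B" "R2 \<subseteq> internal P"
      using insert.prems(3) unfolding R1_def R2_def internal_def by auto
    then have "R2 \<subseteq> V' \<times> V'" unfolding internal_def V'_def by blast
    then have eq: "order_poly V R = (order_poly B R1 * order_poly V' R2 :: 'k poly)"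
      unfolding BV'(1) R(1) by (rule order_poly_Un[OF fin BV'(2) R(2)])
    have "monom 1 1 dvd (order_poly B R1 :: 'k poly)"
      using order_poly_at_0[OF fin(1) B R(2)] by (simp add: poly_eq_0_iff_dvd monom_altdef)
    then have "monom 1 1 * monom 1 (card P) dvd (order_poly V R :: 'k poly)"
      unfolding eq using insert.IH[OF fin(2) part R(3)] by (rule mult_dvd_mono)
    then show ?case using insert.hyps by (simp add: mult_monom)
  qed
qed

text \<open>
  The inversion formula between the leading coefficients (the order volumes) and the lowest
  coefficients of order polynomials. With \<open>\<Omega>\<close> for order polynomials, the lexicographic decomposition
  reads \<open>\<Omega>\<^sub>R(N M) = \<Sum>\<^sub>P \<Omega>\<^bsub>R \<inter> internal P\<^esub>(N) vol(P) M (M - 1) \<dots> (M - |P| + 1)\<close>. As an identity of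
  polynomials in \<open>M\<close> it may be evaluated at \<open>M = 1 / N\<close>, where the left side is \<open>\<Omega>\<^sub>R(1)\<close>. Since
  \<open>\<Omega>\<^bsub>R \<inter> internal P\<^esub>(N)\<close> is divisible by \<open>N\<^bsup>|P|\<^esup>\<close>, the right side is then a polynomial in
  \<open>N\<close>, and its value at \<open>N = 0\<close> is the asserted sum.
\<close>

theorem sum_order_volume_coeff:
  assumes V: "finite V" and R: "R \<subseteq> V \<times> V"
  shows "(\<Sum>P | partition_on V P. order_volume P (quotient_rel P R) *
      coeff (order_poly V (R \<inter> internal P)) (card P)) = (if R = {} then 1 else 0 :: 'k::field_char_0)"
proof -
  define vol where "vol P = (order_volume P (quotient_rel P R) :: 'k)" for P
  define D where "D P = (order_poly V (R \<inter> internal P) div monom 1 (card P) :: 'k poly)" for P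
  define C where "C k = (\<Prod>i<k. [:1, - of_nat i:] :: 'k poly)" for k
  have D: "order_poly V (R \<inter> internal P) = monom 1 (card P) * D P" if "partition_on V P" for P
    using monom_dvd_order_poly[OF V that, of "R \<inter> internal P", where 'k = 'k] unfolding D_def by simp
  have RP: "R \<inter> internal P \<subseteq> V \<times> V" for P using R by auto
  have key: "poly (order_poly V R) 1 = poly (\<Sum>P | partition_on V P. smult (vol P) (D P * C (card P))) (of_nat N)"
    if N: "N > 0" for N
  proof -
    have "pcompose (order_poly V R) [:0, of_nat N:] = (\<Sum>P | partition_on V P.
        smult (poly (order_poly V (R \<inter> internal P)) (of_nat N) * vol P) (falling (card P)))" (is "_ = ?r")
    proof (rule poly_eqI_nat)
      fix M :: nat
      have "poly (pcompose (order_poly V R) [:0, of_nat N:]) (of_nat M) = (of_nat (card (strict_maps V R (N * M))) :: 'k)"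
        by (simp add: poly_pcompose mult.commute flip: of_nat_mult poly_order_poly[OF V R])
      also have "\<dots> = poly ?r (of_nat M)"
        unfolding card_strict_maps_mult[OF V R N] poly_sum of_nat_sum
      proof (rule sum.cong[OF refl])
        fix P assume "P \<in> {P. partition_on V P}"
        then have P: "partition_on V P" by simp
        show "of_nat (card (strict_maps V (R \<inter> internal P) N) *
            card {h \<in> strict_maps P (quotient_rel P R) M. inj_on h P}) =
          poly (smult (poly (order_poly V (R \<inter> internal P)) (of_nat N) * vol P) (falling (card P))) (of_nat M)"
          using of_nat_card_inj_strict_maps[OF finite_elements[OF V P] quotient_rel_subset[OF P R], of M, where 'k = 'k]
          by (simp add: mult.assoc vol_def poly_order_poly[OF V RP])
      qed
      finally show "poly (pcompose (order_poly V R) [:0, of_nat N:]) (of_nat M) = poly ?r (of_nat M)" .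
    qed
    \<comment> \<open>Evaluate at \<open>M = 1 / N\<close>.\<close>
    then have "poly (pcompose (order_poly V R) [:0, of_nat N:]) (1 / of_nat N) = poly ?r (1 / of_nat N)" by simp
    then have "poly (order_poly V R) 1 = poly ?r (1 / of_nat N)" using N by (simp add: poly_pcompose)
    also have "\<dots> = poly (\<Sum>P | partition_on V P. smult (vol P) (D P * C (card P))) (of_nat N)"
      unfolding poly_sum
    proof (rule sum.cong[OF refl])
      fix P assume "P \<in> {P. partition_on V P}"
      then have P: "partition_on V P" by simp
      have "of_nat N ^ k * poly (falling k) (1 / of_nat N) = (poly (C k) (of_nat N) :: 'k)" for k
        using N by (induction k) (simp_all add: C_def falling_def field_simps)
      then show "poly (smult (poly (order_poly V (R \<inter> internal P)) (of_nat N) * vol P) (falling (card P))) (1 / of_nat N)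
          = poly (smult (vol P) (D P * C (card P))) (of_nat N)"
        unfolding D[OF P] by (simp add: poly_monom mult_ac)
    qed
    finally show ?thesis .
  qed
  have D0: "coeff (D P * C k) 0 = coeff (D P) 0" for P k
    by (simp add: C_def poly_prod flip: poly_0_coeff_0)
  have "[:poly (order_poly V R) 1:] = (\<Sum>P | partition_on V P. smult (vol P) (D P * C (card P)))"
    by (rule poly_eqI_nat) (use key in simp)
  \<comment> \<open>Evaluate at \<open>N = 0\<close>.\<close>
  then have "poly [:poly (order_poly V R) 1:] 0 = poly (\<Sum>P | partition_on V P. smult (vol P) (D P * C (card P))) 0" by (rule arg_cong)
  also have "\<dots> = (\<Sum>P | partition_on V P. vol P * coeff (order_poly V (R \<inter> internal P)) (card P))"
    unfolding poly_sum
    by (rule sum.cong) (simp_all add: D D0 coeff_monom_mult poly_0_coeff_0)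
  finally show ?thesis using order_poly_at_1[OF V R, where 'k = 'k] by (simp add: vol_def)
qed

section \<open>The linear coefficient for a labelled vertex set\<close>

text \<open>
  Weakly increasing maps on \<open>{1, \<dots>, n}\<close> that increase strictly from \<open>a\<close> to \<open>a + 1\<close> whenever
  \<open>s a\<close> holds.
\<close>

definition chain_maps :: "nat \<Rightarrow> nat \<Rightarrow> (nat \<Rightarrow> bool) \<Rightarrow> (nat \<Rightarrow> nat) set" where
  "chain_maps n N s = {g \<in> {1..n} \<rightarrow>\<^sub>E {..<N}. \<forall>a\<in>{1..<n}. if s a then g a < g (Suc a) else g a \<le> g (Suc a)}"

lemma le_last:
  fixes f :: "nat \<Rightarrow> nat"
  assumes "\<And>a. a \<in> {1..<n} \<Longrightarrow> f a \<le> f (Suc a)" "a \<in> {1..n}"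
  shows "f a \<le> f n"
proof -
  have "a \<le> n" "1 \<le> a" using assms(2) by auto
  then show ?thesis
  proof (induction rule: inc_induct)
    case (step m)
    then have "f m \<le> f (Suc m)" using assms(1) by simp
    then show ?case using step by simp
  qed simp
qed

lemma sum_choose_shift: "k \<le> n \<Longrightarrow> (\<Sum>j<N. (j + k) choose n) = (N + k) choose Suc n"
  by (induction N) (auto simp: binomial_eq_0)

lemma card_chain_maps:
  assumes "n \<ge> 1"
  shows "card (chain_maps n N s) = (N + card {a \<in> {1..<n}. \<not> s a}) choose n"
  using assms
proof (induction n arbitrary: N rule: dec_induct)
  case base
  have "chain_maps 1 N s = {1} \<rightarrow>\<^sub>E {..<N}" by (simp add: chain_maps_def)
  then show ?case by (simp add: card_PiE)
next
  case (step n)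
  \<comment> \<open>If the last value is \<open>j\<close>, then the preceding value is below \<open>K j\<close>.\<close>
  define K where "K j = (if s n then j else Suc j)" for j :: nat
  have iv: "{1..Suc n} = insert (Suc n) {1..n}" "{1..<Suc n} = insert n {1..<n}"
    using step.hyps by auto
  have "bij_betw (\<lambda>g. (g (Suc n), restrict g {1..n})) (chain_maps (Suc n) N s)
      (SIGMA j : {..<N}. chain_maps n (K j) s)"
  proof (rule bij_betw_byWitness[where f' = "\<lambda>(j, g). g(Suc n := j)"])
    show "\<forall>f\<in>chain_maps (Suc n) N s. (\<lambda>(j, g). g(Suc n := j)) (f (Suc n), restrict f {1..n}) = f"
      unfolding chain_maps_def by (auto simp: fun_eq_iff PiE_def extensional_def)
    show "\<forall>x\<in>SIGMA j : {..<N}. chain_maps n (K j) s.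
        (\<lambda>f. (f (Suc n), restrict f {1..n})) ((\<lambda>(j, g). g(Suc n := j)) x) = x"
      unfolding chain_maps_def by (auto simp: fun_eq_iff PiE_def extensional_def)
    show "(\<lambda>f. (f (Suc n), restrict f {1..n})) ` chain_maps (Suc n) N s
        \<subseteq> (SIGMA j : {..<N}. chain_maps n (K j) s)"
    proof clarify
      fix f assume f: "f \<in> chain_maps (Suc n) N s"
      have "f (Suc n) < N" using f unfolding chain_maps_def by auto
      moreover have st: "if s a then f a < f (Suc a) else f a \<le> f (Suc a)" if "a \<in> {1..<Suc n}" for a
        using f that unfolding chain_maps_def by simp
      have "restrict f {1..n} \<in> chain_maps n (Suc (f n)) s"
      proof -
        have "f a \<le> f n" if "a \<in> {1..n}" for a
        proof (rule le_last[OF _ that])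
          fix b assume "b \<in> {1..<n}"
          then show "f b \<le> f (Suc b)" using st[of b] by (auto intro: less_imp_le split: if_splits)
        qed
        then show ?thesis using st unfolding chain_maps_def by (auto simp: less_Suc_eq_le)
      qed
      moreover have "f n < K (f (Suc n))"
        using st[of n] step.hyps by (auto simp: K_def less_Suc_eq_le split: if_splits)
      then have "chain_maps n (Suc (f n)) s \<subseteq> chain_maps n (K (f (Suc n))) s"
        unfolding chain_maps_def by (fastforce simp: PiE_def Pi_def)
      ultimately show "f (Suc n) \<in> {..<N} \<and> restrict f {1..n} \<in> chain_maps n (K (f (Suc n))) s" by auto
    qed
    show "(\<lambda>(j, g). g(Suc n := j)) ` (SIGMA j : {..<N}. chain_maps n (K j) s) \<subseteq> chain_maps (Suc n) N s"
    proof
      fix h assume "h \<in> (\<lambda>(j, g). g(Suc n := j)) ` (SIGMA j : {..<N}. chain_maps n (K j) s)"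
      then obtain j g where j: "j < N" and g: "g \<in> chain_maps n (K j) s" and h: "h = g(Suc n := j)" by auto
      have gK: "g a < K j" if "a \<in> {1..n}" for a using g that unfolding chain_maps_def by auto
      then have "g a < N" if "a \<in> {1..n}" for a
        using j that less_le_trans[of "g a" "K j" N] by (auto simp: K_def split: if_splits)
      then have "h \<in> {1..Suc n} \<rightarrow>\<^sub>E {..<N}"
        using g j unfolding chain_maps_def h iv by (auto simp: PiE_def Pi_def extensional_def)
      moreover have "if s a then h a < h (Suc a) else h a \<le> h (Suc a)" if "a \<in> {1..<Suc n}" for a
      proof (cases "a = n")
        case True
        then show ?thesis using gK[of n] step.hyps by (auto simp: h K_def split: if_splits)
      next
        case False
        then show ?thesis using g that unfolding chain_maps_def h by auto
      qed
      ultimately show "h \<in> chain_maps (Suc n) N s" unfolding chain_maps_def by blast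
    qed
  qed
  moreover have "finite (chain_maps n M s)" for M
    unfolding chain_maps_def by (rule finite_subset[OF Collect_restrict]) (auto intro: finite_PiE)
  ultimately have "card (chain_maps (Suc n) N s) = (\<Sum>j<N. card (chain_maps n (K j) s))"
    by (simp add: bij_betw_same_card)
  also have "\<dots> = (\<Sum>j<N. (j + card {a \<in> {1..<Suc n}. \<not> s a}) choose n)"
  proof (rule sum.cong[OF refl])
    fix j
    have "{a \<in> {1..<Suc n}. \<not> s a} = {a \<in> {1..<n}. \<not> s a} \<union> (if s n then {} else {n})"
      unfolding iv by auto
    then have "card {a \<in> {1..<Suc n}. \<not> s a} = card {a \<in> {1..<n}. \<not> s a} + (if s n then 0 else 1)" by auto
    then show "card (chain_maps n (K j) s) = (j + card {a \<in> {1..<Suc n}. \<not> s a}) choose n"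
      unfolding step.IH by (simp add: K_def)
  qed
  also have "\<dots> = (N + card {a \<in> {1..<Suc n}. \<not> s a}) choose Suc n"
  proof (rule sum_choose_shift)
    have "card {a \<in> {1..<Suc n}. \<not> s a} \<le> card {1..<Suc n}" by (rule card_mono) auto
    then show "card {a \<in> {1..<Suc n}. \<not> s a} \<le> n" by simp
  qed
  finally show ?case .
qed

text \<open>
  The linear order in which \<open>f\<close> lists its arguments: by increasing value, and by decreasing
  argument among equal values.
\<close>

definition sorts_before :: "(nat \<Rightarrow> nat) \<Rightarrow> nat \<Rightarrow> nat \<Rightarrow> bool" where
  "sorts_before f i j \<longleftrightarrow> f i < f j \<or> f i = f j \<and> j < i"

text \<open>The maps into \<open>{0, \<dots>, N - 1}\<close> that list \<open>{1, \<dots>, n}\<close> as the word \<open>\<sigma>\<close>.\<close>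

definition sorted_by :: "nat \<Rightarrow> nat \<Rightarrow> (nat \<Rightarrow> nat) \<Rightarrow> (nat \<Rightarrow> nat) set" where
  "sorted_by n N \<sigma> = {f \<in> {1..n} \<rightarrow>\<^sub>E {..<N}.
     \<forall>i\<in>{1..n}. \<forall>j\<in>{1..n}. sorts_before f i j \<longleftrightarrow> inv \<sigma> i < inv \<sigma> j}"

lemma sorts_before_trans: "sorts_before f i j \<Longrightarrow> sorts_before f j k \<Longrightarrow> sorts_before f i k"
  unfolding sorts_before_def by auto

lemma sorts_before_linear: "i \<noteq> j \<Longrightarrow> sorts_before f i j \<or> sorts_before f j i"
  unfolding sorts_before_def by auto

lemma sorts_before_asym: "sorts_before f i j \<Longrightarrow> \<not> sorts_before f j i"
  unfolding sorts_before_def by auto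

lemma sorted_by_iff:
  assumes s: "\<sigma> permutes {1..n}" and f: "f \<in> {1..n} \<rightarrow>\<^sub>E {..<N}"
  shows "f \<in> sorted_by n N \<sigma> \<longleftrightarrow> (\<forall>a\<in>{1..<n}. sorts_before f (\<sigma> a) (\<sigma> (Suc a)))"
proof
  assume "f \<in> sorted_by n N \<sigma>"
  then have *: "sorts_before f i j \<longleftrightarrow> inv \<sigma> i < inv \<sigma> j" if "i \<in> {1..n}" "j \<in> {1..n}" for i j
    using that unfolding sorted_by_def by auto
  show "\<forall>a\<in>{1..<n}. sorts_before f (\<sigma> a) (\<sigma> (Suc a))"
  proof
    fix a assume "a \<in> {1..<n}"
    then have "\<sigma> a \<in> {1..n}" "\<sigma> (Suc a) \<in> {1..n}" using permutes_in_image[OF s] by auto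
    then show "sorts_before f (\<sigma> a) (\<sigma> (Suc a))"
      using *[of "\<sigma> a" "\<sigma> (Suc a)"] permutes_inverses[OF s] by simp
  qed
next
  assume st: "\<forall>a\<in>{1..<n}. sorts_before f (\<sigma> a) (\<sigma> (Suc a))"
  have lt: "sorts_before f (\<sigma> a) (\<sigma> b)" if "1 \<le> a" "Suc a \<le> b" "b \<le> n" for a b
    using that(2,3)
  proof (induction b rule: dec_induct)
    case base
    then show ?case using st that(1) by auto
  next
    case (step m)
    then have "sorts_before f (\<sigma> m) (\<sigma> (Suc m))" using st that(1) by auto
    moreover have "sorts_before f (\<sigma> a) (\<sigma> m)" using step by simp
    ultimately show ?case using sorts_before_trans by blast
  qed
  have "sorts_before f i j \<longleftrightarrow> inv \<sigma> i < inv \<sigma> j" if ij: "i \<in> {1..n}" "j \<in> {1..n}" for i j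
  proof -
    have in': "inv \<sigma> i \<in> {1..n}" "inv \<sigma> j \<in> {1..n}"
      using ij permutes_in_image[OF permutes_inv[OF s]] by blast+
    have eq: "\<sigma> (inv \<sigma> i) = i" "\<sigma> (inv \<sigma> j) = j" using permutes_inverses[OF s] by auto
    show ?thesis
    proof (cases "inv \<sigma> i" "inv \<sigma> j" rule: linorder_cases)
      case less
      then show ?thesis using lt[of "inv \<sigma> i" "inv \<sigma> j"] in' eq by auto
    next
      case equal
      then have "i = j" using eq by metis
      then show ?thesis by (simp add: sorts_before_def)
    next
      case greater
      then show ?thesis using lt[of "inv \<sigma> j" "inv \<sigma> i"] in' eq sorts_before_asym by auto
    qed
  qed
  then show "f \<in> sorted_by n N \<sigma>" using f unfolding sorted_by_def by blast
qed

lemma descents_eq: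
  assumes "\<sigma> permutes {1..n}"
  shows "descents n \<sigma> = card {a \<in> {1..<n}. \<not> \<sigma> a < \<sigma> (Suc a)}"
proof -
  have "\<sigma> a \<noteq> \<sigma> (Suc a)" for a using inj_eq[OF permutes_inj[OF assms]] by simp
  then have "\<sigma> (Suc a) < \<sigma> a \<longleftrightarrow> \<not> \<sigma> a < \<sigma> (Suc a)" for a by (metis linorder_neqE_nat less_asym)
  moreover have "{1..n - 1} = {1..<n}" by auto
  ultimately show ?thesis unfolding descents_def by simp
qed

text \<open>
  Along the word \<open>\<sigma>\<close> the values of such a map must increase strictly at the ascents and weakly at the
  descents.
\<close>

lemma card_sorted_by:
  assumes s: "\<sigma> permutes {1..n}" and n: "n \<ge> 1"
  shows "card (sorted_by n N \<sigma>) = (N + descents n \<sigma>) choose n"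
proof -
  have "bij_betw (\<lambda>f. \<lambda>a\<in>{1..n}. f (\<sigma> a)) (sorted_by n N \<sigma>) (chain_maps n N (\<lambda>a. \<sigma> a < \<sigma> (Suc a)))"
  proof (rule bij_betw_byWitness[where f' = "\<lambda>g. \<lambda>i\<in>{1..n}. g (inv \<sigma> i)"])
    have s_in: "\<sigma> a \<in> {1..n} \<longleftrightarrow> a \<in> {1..n}" "inv \<sigma> a \<in> {1..n} \<longleftrightarrow> a \<in> {1..n}" for a
      using permutes_in_image[OF s] permutes_in_image[OF permutes_inv[OF s]] by blast+
    have ext: "f i = undefined" if "f \<in> {1..n} \<rightarrow>\<^sub>E {..<N}" "i \<notin> {1..n}" for f :: "nat \<Rightarrow> nat" and i
      using that by (rule PiE_arb)
    show "\<forall>f\<in>sorted_by n N \<sigma>. (\<lambda>i\<in>{1..n}. (\<lambda>a\<in>{1..n}. f (\<sigma> a)) (inv \<sigma> i)) = f"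
      using s_in ext permutes_inverses[OF s] by (auto simp: sorted_by_def fun_eq_iff simp del: atLeastAtMost_iff)
    show "\<forall>g\<in>chain_maps n N (\<lambda>a. \<sigma> a < \<sigma> (Suc a)). (\<lambda>a\<in>{1..n}. (\<lambda>i\<in>{1..n}. g (inv \<sigma> i)) (\<sigma> a)) = g"
      using s_in ext permutes_inverses[OF s] by (auto simp: chain_maps_def fun_eq_iff simp del: atLeastAtMost_iff)
    have step: "sorts_before f (\<sigma> a) (\<sigma> (Suc a)) \<longleftrightarrow>
        (if \<sigma> a < \<sigma> (Suc a) then f (\<sigma> a) < f (\<sigma> (Suc a)) else f (\<sigma> a) \<le> f (\<sigma> (Suc a)))" for f a
      using inj_eq[OF permutes_inj[OF s], of a "Suc a"]
      by (cases "\<sigma> a" "\<sigma> (Suc a)" rule: linorder_cases) (auto simp: sorts_before_def)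
    show "(\<lambda>f. \<lambda>a\<in>{1..n}. f (\<sigma> a)) ` sorted_by n N \<sigma> \<subseteq> chain_maps n N (\<lambda>a. \<sigma> a < \<sigma> (Suc a))"
    proof clarify
      fix f assume f: "f \<in> sorted_by n N \<sigma>"
      then have fP: "f \<in> {1..n} \<rightarrow>\<^sub>E {..<N}" by (simp add: sorted_by_def)
      have "(\<lambda>a\<in>{1..n}. f (\<sigma> a)) \<in> {1..n} \<rightarrow>\<^sub>E {..<N}"
        using PiE_mem[OF fP] s_in by (simp del: atLeastAtMost_iff)
      moreover have "\<forall>a\<in>{1..<n}. if \<sigma> a < \<sigma> (Suc a) then f (\<sigma> a) < f (\<sigma> (Suc a)) else f (\<sigma> a) \<le> f (\<sigma> (Suc a))"
        using f sorted_by_iff[OF s fP] step by blast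
      ultimately show "(\<lambda>a\<in>{1..n}. f (\<sigma> a)) \<in> chain_maps n N (\<lambda>a. \<sigma> a < \<sigma> (Suc a))"
        unfolding chain_maps_def by simp
    qed
    show "(\<lambda>g. \<lambda>i\<in>{1..n}. g (inv \<sigma> i)) ` chain_maps n N (\<lambda>a. \<sigma> a < \<sigma> (Suc a)) \<subseteq> sorted_by n N \<sigma>"
    proof clarify
      fix g assume g: "g \<in> chain_maps n N (\<lambda>a. \<sigma> a < \<sigma> (Suc a))"
      then have gP: "g \<in> {1..n} \<rightarrow>\<^sub>E {..<N}" by (simp add: chain_maps_def)
      let ?f = "\<lambda>i\<in>{1..n}. g (inv \<sigma> i)"
      have fP: "?f \<in> {1..n} \<rightarrow>\<^sub>E {..<N}"
        using PiE_mem[OF gP] s_in by (simp del: atLeastAtMost_iff)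
      have fs: "?f (\<sigma> a) = g a" if "a \<in> {1..n}" for a
        using that s_in permutes_inverses[OF s] by (simp del: atLeastAtMost_iff)
      have "sorts_before ?f (\<sigma> a) (\<sigma> (Suc a))" if "a \<in> {1..<n}" for a
      proof -
        have "a \<in> {1..n}" "Suc a \<in> {1..n}" using that by auto
        note fa = fs[OF this(1)] fs[OF this(2)]
        have "if \<sigma> a < \<sigma> (Suc a) then g a < g (Suc a) else g a \<le> g (Suc a)"
          using g that unfolding chain_maps_def by blast
        then show ?thesis by (simp only: step fa)
      qed
      then show "?f \<in> sorted_by n N \<sigma>" using sorted_by_iff[OF s fP] by blast
    qed
  qed
  then show ?thesis using card_chain_maps[OF n] descents_eq[OF s] by (simp add: bij_betw_same_card)
qed

lemma permutes_eq_card_less: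
  assumes "p permutes {1..n}" "i \<in> {1..n}"
  shows "p i = Suc (card {j \<in> {1..n}. p j < p i})"
proof -
  have pi: "p i \<in> {1..n}" using permutes_in_image[OF assms(1)] assms(2) by simp
  have "p ` {j \<in> {1..n}. p j < p i} = {1..<p i}"
  proof (intro equalityI subsetI)
    fix x assume "x \<in> {1..<p i}"
    then have "x \<in> p ` {1..n}" "x < p i" using pi permutes_image[OF assms(1)] by auto
    then show "x \<in> p ` {j \<in> {1..n}. p j < p i}" by auto
  next
    fix x assume "x \<in> p ` {j \<in> {1..n}. p j < p i}"
    then show "x \<in> {1..<p i}" using permutes_in_image[OF assms(1)] by fastforce
  qed
  then have "card {j \<in> {1..n}. p j < p i} = card {1..<p i}"
    using card_image[OF inj_on_subset[OF permutes_inj[OF assms(1)]], of "{j \<in> {1..n}. p j < p i}"] by simp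
  then show ?thesis using pi by simp
qed

lemma sorted_by_disjoint:
  assumes "\<sigma> permutes {1..n}" "\<tau> permutes {1..n}" "f \<in> sorted_by n N \<sigma>" "f \<in> sorted_by n N \<tau>"
  shows "\<sigma> = \<tau>"
proof -
  have "inv \<sigma> i = inv \<tau> i" for i
  proof (cases "i \<in> {1..n}")
    case True
    have "{j \<in> {1..n}. inv \<sigma> j < inv \<sigma> i} = {j \<in> {1..n}. inv \<tau> j < inv \<tau> i}"
      using assms(3,4) True unfolding sorted_by_def by auto
    then show ?thesis
      using permutes_eq_card_less[OF permutes_inv[OF assms(1)] True]
        permutes_eq_card_less[OF permutes_inv[OF assms(2)] True] by simp
  next
    case False
    then show ?thesis using permutes_inv[OF assms(1)] permutes_inv[OF assms(2)] by (metis permutes_not_in)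
  qed
  then have "inv (inv \<sigma>) = inv (inv \<tau>)" by presburger
  then show ?thesis using permutes_inv_inv assms by metis
qed

lemma sorted_by_exists:
  assumes f: "f \<in> {1..n} \<rightarrow>\<^sub>E {..<N}"
  shows "\<exists>\<sigma>. \<sigma> permutes {1..n} \<and> f \<in> sorted_by n N \<sigma>"
proof -
  define pos where "pos i = Suc (card {j \<in> {1..n}. sorts_before f j i})" for i
  define p where "p i = (if i \<in> {1..n} then pos i else i)" for i
  have less: "pos i < pos j" if "i \<in> {1..n}" "sorts_before f i j" for i j
  proof -
    have "{k \<in> {1..n}. sorts_before f k i} \<subset> {k \<in> {1..n}. sorts_before f k j}"
      using that sorts_before_trans[of f _ i j] sorts_before_asym[of f i i] by blast
    then show ?thesis unfolding pos_def by (simp add: psubset_card_mono)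
  qed
  have iff: "sorts_before f i j \<longleftrightarrow> pos i < pos j" if "i \<in> {1..n}" "j \<in> {1..n}" for i j
    using less[of i j] less[of j i] that sorts_before_linear[of i j f] by (metis less_asym less_irrefl)
  have inj: "inj_on p {1..n}"
    using less sorts_before_linear[of _ _ f] unfolding inj_on_def p_def by (metis less_irrefl)
  have "pos i \<le> n" if "i \<in> {1..n}" for i
  proof -
    have "{k \<in> {1..n}. sorts_before f k i} \<subset> {1..n}" using that sorts_before_asym[of f i i] by blast
    then have "card {k \<in> {1..n}. sorts_before f k i} < card {1..n}" by (rule psubset_card_mono[rotated]) simp
    then show ?thesis unfolding pos_def by simp
  qed
  then have "p ` {1..n} \<subseteq> {1..n}" unfolding p_def pos_def by auto
  then have "bij_betw p {1..n} {1..n}"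
    using inj by (simp add: bij_betw_def endo_inj_surj)
  then have p: "p permutes {1..n}" by (rule bij_imp_permutes) (unfold p_def, rule if_not_P)
  have "f \<in> sorted_by n N (inv p)"
    unfolding sorted_by_def using f iff by (simp add: permutes_inv_inv[OF p] p_def)
  then show ?thesis using permutes_inv[OF p] by blast
qed

text \<open>
  If \<open>a < b\<close>, then \<open>f a < f b\<close> holds exactly if \<open>a\<close> precedes \<open>b\<close> in the word that \<open>f\<close> determines,
  because equal values are listed by decreasing argument. So strictness depends only on that word.
\<close>

lemma card_strict_maps_labelled:
  assumes n: "n \<ge> 1" and R: "R \<subseteq> {1..n} \<times> {1..n}" "\<And>a b. (a, b) \<in> R \<Longrightarrow> a < b"
  shows "card (strict_maps {1..n} R N) =
    (\<Sum>\<sigma> | \<sigma> permutes {1..n} \<and> (\<forall>(a, b)\<in>R. inv \<sigma> a < inv \<sigma> b). (N + descents n \<sigma>) choose n)"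
proof -
  let ?C = "{\<sigma>. \<sigma> permutes {1..n} \<and> (\<forall>(a, b)\<in>R. inv \<sigma> a < inv \<sigma> b)}"
  have iff: "(\<forall>(a, b)\<in>R. f a < f b) \<longleftrightarrow> (\<forall>(a, b)\<in>R. inv \<sigma> a < inv \<sigma> b)" if f: "f \<in> sorted_by n N \<sigma>" for f \<sigma>
  proof -
    have "f a < f b \<longleftrightarrow> inv \<sigma> a < inv \<sigma> b" if "(a, b) \<in> R" for a b
    proof -
      have "sorts_before f a b \<longleftrightarrow> inv \<sigma> a < inv \<sigma> b" using f that R(1) unfolding sorted_by_def by blast
      then show ?thesis using R(2)[OF that] by (auto simp: sorts_before_def)
    qed
    then show ?thesis by blast
  qed
  have U: "strict_maps {1..n} R N = (\<Union>\<sigma>\<in>?C. sorted_by n N \<sigma>)"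
  proof (intro equalityI subsetI)
    fix f assume "f \<in> strict_maps {1..n} R N"
    then have f: "f \<in> {1..n} \<rightarrow>\<^sub>E {..<N}" "\<forall>(a, b)\<in>R. f a < f b" unfolding strict_maps_def by simp_all
    then show "f \<in> (\<Union>\<sigma>\<in>?C. sorted_by n N \<sigma>)" using sorted_by_exists[OF f(1)] iff by auto
  next
    fix f assume "f \<in> (\<Union>\<sigma>\<in>?C. sorted_by n N \<sigma>)"
    then obtain \<sigma> where "\<sigma> \<in> ?C" "f \<in> sorted_by n N \<sigma>" by blast
    then show "f \<in> strict_maps {1..n} R N"
      using iff[of f \<sigma>] unfolding strict_maps_def by (auto simp: sorted_by_def)
  qed
  have "finite (sorted_by n N \<sigma>)" for \<sigma>
    unfolding sorted_by_def by (rule finite_subset[OF Collect_restrict]) (auto intro: finite_PiE)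
  moreover have fin: "finite ?C"
    by (rule finite_subset[OF _ finite_permutations[of "{1..n}"]]) auto
  ultimately have "card (strict_maps {1..n} R N) = (\<Sum>\<sigma>\<in>?C. card (sorted_by n N \<sigma>))"
    unfolding U using sorted_by_disjoint by (intro card_UN_disjoint) blast+
  also have "\<dots> = (\<Sum>\<sigma>\<in>?C. (N + descents n \<sigma>) choose n)"
    by (intro sum.cong refl card_sorted_by[OF _ n]) simp
  finally show ?thesis .
qed

text \<open>
  The number \<open>d\<^bsub>n,k\<^esub>\<close> is the linear coefficient of the polynomial \<open>(N + k) choose n\<close> in \<open>N\<close>, whose
  factor for \<open>i = k\<close> is \<open>N\<close> itself.
\<close>

lemma coeff_1_shifted_falling:
  assumes k: "k < n"
  shows "coeff (\<Prod>i<n. [:of_nat k - of_nat i, 1:]) 1 = (fact n * d_coeff n k :: 'k::field_char_0)"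
proof -
  have A: "(\<Prod>i<k. of_nat k - of_nat i :: 'k) = fact k"
    using k by (simp add: fact_prod_rev atLeast0LessThan of_nat_diff)
  have B: "(\<Prod>i\<in>{Suc k..<Suc k + m}. of_nat k - of_nat i :: 'k) = (- 1) ^ m * fact m" for m
    by (induction m) (simp_all add: algebra_simps)
  have C: "(\<Prod>i\<in>{Suc k..<n}. of_nat k - of_nat i :: 'k) = (- 1) ^ (n - 1 - k) * fact (n - 1 - k)"
    using B[of "n - 1 - k"] k by simp
  have iv: "{..<n} - {k} = {..<k} \<union> {Suc k..<n}" using k by auto
  have "(\<Prod>i<n. [:of_nat k - of_nat i, 1:]) = ([:0, 1:] * (\<Prod>i\<in>{..<n} - {k}. [:of_nat k - of_nat i, 1:]) :: 'k poly)"
    using k by (subst prod.remove[of _ k]) auto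
  then have "coeff (\<Prod>i<n. [:of_nat k - of_nat i, 1:]) 1 = poly (\<Prod>i\<in>{..<n} - {k}. [:of_nat k - of_nat i, 1:] :: 'k poly) 0"
    by (simp add: poly_0_coeff_0)
  also have "\<dots> = (\<Prod>i\<in>{..<k} \<union> {Suc k..<n}. of_nat k - of_nat i)"
    by (simp add: poly_prod iv)
  also have "\<dots> = (\<Prod>i<k. of_nat k - of_nat i) * (\<Prod>i\<in>{Suc k..<n}. of_nat k - of_nat i)"
    by (rule prod.union_disjoint) auto
  also have "\<dots> = fact n * d_coeff n k"
  proof -
    have "(fact n :: 'k) = of_nat n * fact (n - 1)" using k by (intro fact_reduce) simp
    then show ?thesis
      using k binomial_fact[of k "n - 1", where 'a = 'k] unfolding A C d_coeff_def by simp
  qed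
  finally show ?thesis .
qed

theorem coeff_1_order_poly_labelled:
  assumes n: "n \<ge> 1" and R: "R \<subseteq> {1..n} \<times> {1..n}" "\<And>a b. (a, b) \<in> R \<Longrightarrow> a < b"
  shows "coeff (order_poly {1..n} R) 1 =
    (\<Sum>\<sigma> | \<sigma> permutes {1..n} \<and> (\<forall>(a, b)\<in>R. inv \<sigma> a < inv \<sigma> b). d_coeff n (descents n \<sigma>) :: 'k::field_char_0)"
proof -
  have "order_poly {1..n} R = (\<Sum>\<sigma> | \<sigma> permutes {1..n} \<and> (\<forall>(a, b)\<in>R. inv \<sigma> a < inv \<sigma> b).
     smult (1 / fact n) (\<Prod>i<n. [:of_nat (descents n \<sigma>) - of_nat i, 1:] :: 'k poly))"
  proof (rule order_poly_eqI[OF _ R(1)])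
    fix N :: nat
    have "of_nat (card (strict_maps {1..n} R N)) =
      (\<Sum>\<sigma> | \<sigma> permutes {1..n} \<and> (\<forall>(a, b)\<in>R. inv \<sigma> a < inv \<sigma> b).
         of_nat ((N + descents n \<sigma>) choose n) :: 'k)"
      by (simp only: card_strict_maps_labelled[OF n R] of_nat_sum)
    then show "poly (\<Sum>\<sigma> | \<sigma> permutes {1..n} \<and> (\<forall>(a, b)\<in>R. inv \<sigma> a < inv \<sigma> b).
        smult (1 / fact n) (\<Prod>i<n. [:of_nat (descents n \<sigma>) - of_nat i, 1:] :: 'k poly)) (of_nat N) =
      of_nat (card (strict_maps {1..n} R N))"
      by (simp add: poly_sum poly_prod binomial_gbinomial gbinomial_prod_rev atLeast0LessThan algebra_simps)
  qed simp
  moreover have "descents n \<sigma> < n" for \<sigma>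
  proof -
    have "descents n \<sigma> \<le> card {1..n - 1}" unfolding descents_def by (rule card_mono) auto
    then show ?thesis using n by simp
  qed
  ultimately show ?thesis by (simp add: coeff_sum coeff_1_shifted_falling flip: One_nat_def)
qed

section \<open>Components and contractions of quivers\<close>

text \<open>The vertex sets of the connected components, which are the vertices of a contraction.\<close>

definition components :: "('v, 'e) pre_digraph \<Rightarrow> 'v set set" where
  "components H = component_of H ` verts H"

text \<open>
  The pairs (head, tail) of the arcs in \<open>S\<close>, matching the reading of an edge \<open>u \<rightarrow> v\<close> as \<open>v \<le> u\<close>.
\<close>

definition arc_rel :: "('v, 'e) pre_digraph \<Rightarrow> 'e set \<Rightarrow> 'v rel" where
  "arc_rel G S = (\<lambda>\<epsilon>. (head G \<epsilon>, tail G \<epsilon>)) ` S"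

context wf_digraph begin

lemma component_of_eq: "component_of G v = {w. v \<rightarrow>\<^sup>*\<^bsub>with_proj (mk_symmetric G)\<^esub> w}"
proof -
  interpret S: pair_wf_digraph "mk_symmetric G" ..
  have "w \<rightarrow>\<^sup>*\<^bsub>with_proj (mk_symmetric G)\<^esub> v" if "v \<rightarrow>\<^sup>*\<^bsub>with_proj (mk_symmetric G)\<^esub> w" for w
    by (rule symmetric_reachable[OF symmetric_mk_symmetric that])
  then show ?thesis unfolding component_of_def S.scc_of_def by auto
qed

lemma mem_component_of_iff:
  assumes "u \<in> verts G" "v \<in> verts G"
  shows "u \<in> component_of G v \<longleftrightarrow> component_of G u = component_of G v"
proof -
  interpret S: pair_wf_digraph "mk_symmetric G" ..
  let ?r = "\<lambda>x y. x \<rightarrow>\<^sup>*\<^bsub>with_proj (mk_symmetric G)\<^esub> y"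
  have sym: "?r y x" if "?r x y" for x y
    by (rule symmetric_reachable[OF symmetric_mk_symmetric that])
  have trans: "?r x z" if "?r x y" "?r y z" for x y z
    using that by (rule S.reachable_trans)
  have refl: "?r u u" using assms by simp
  show ?thesis
  proof
    assume "u \<in> component_of G v"
    then have vu: "?r v u" unfolding component_of_eq by simp
    show "component_of G u = component_of G v"
      unfolding component_of_eq using trans[OF vu] trans[OF sym[OF vu]] by blast
  next
    assume "component_of G u = component_of G v"
    then show "u \<in> component_of G v" using refl unfolding component_of_eq by blast
  qed
qed

lemma component_of_subset: "component_of G v \<subseteq> verts G"
proof -
  interpret S: pair_wf_digraph "mk_symmetric G" ..
  show ?thesis unfolding component_of_eq using S.reachable_in_verts by auto
qed

lemma partition_on_components: "partition_on (verts G) (components G)"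
proof (rule partition_onI)
  show "\<Union>(components G) = verts G"
    unfolding components_def using component_of_subset mem_component_of_iff by blast
  show "{} \<notin> components G" unfolding components_def using mem_component_of_iff by blast
  fix A B assume "A \<in> components G" "B \<in> components G" "A \<noteq> B"
  then obtain u v where uv: "u \<in> verts G" "A = component_of G u" "v \<in> verts G" "B = component_of G v"
    unfolding components_def by blast
  show "disjnt A B"
    unfolding disjnt_iff
  proof (intro allI notI)
    fix x assume x: "x \<in> A \<and> x \<in> B"
    then have "x \<in> verts G" using uv component_of_subset by blast
    then show False using x uv mem_component_of_iff \<open>A \<noteq> B\<close> by metis
  qed
qed

lemma block_components: "v \<in> verts G \<Longrightarrow> block (components G) v = component_of G v"
  by (rule block_eq[OF partition_on_components]) (use mem_component_of_iff in \<open>auto simp: components_def\<close>)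

lemma component_of_tail_head:
  assumes "\<epsilon> \<in> arcs G"
  shows "component_of G (tail G \<epsilon>) = component_of G (head G \<epsilon>)"
proof -
  interpret S: pair_wf_digraph "mk_symmetric G" ..
  have "(head G \<epsilon>, tail G \<epsilon>) \<in> parcs (mk_symmetric G)" using assms by (auto simp: parcs_mk_symmetric)
  then have "head G \<epsilon> \<rightarrow>\<^sup>*\<^bsub>with_proj (mk_symmetric G)\<^esub> tail G \<epsilon>"
    by (intro S.reachable_adjI) simp
  then have "tail G \<epsilon> \<in> component_of G (head G \<epsilon>)" unfolding component_of_eq by simp
  then show ?thesis using assms mem_component_of_iff by simp
qed

lemma refines_components:
  assumes P: "partition_on (verts G) P" and sub: "arc_rel G (arcs G) \<subseteq> internal P"
  shows "refines (verts G) (components G) P"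
  unfolding refines_def
proof (intro conjI ballI)
  interpret S: pair_wf_digraph "mk_symmetric G" ..
  show "partition_on (verts G) P" by (rule P)
  show "partition_on (verts G) (components G)" by (rule partition_on_components)
  have step: "block P x = block P y" if xy: "(x, y) \<in> parcs (mk_symmetric G)" for x y
  proof -
    obtain \<epsilon> where e: "\<epsilon> \<in> arcs G" and xy: "(x, y) = (tail G \<epsilon>, head G \<epsilon>) \<or> (x, y) = (head G \<epsilon>, tail G \<epsilon>)"
      using xy unfolding parcs_mk_symmetric by blast
    have "(head G \<epsilon>, tail G \<epsilon>) \<in> internal P" using sub e by (auto simp: arc_rel_def)
    then have "block P (head G \<epsilon>) = block P (tail G \<epsilon>)" using internal_iff[OF P] e by simp
    then show ?thesis using xy by auto
  qed
  fix A assume "A \<in> components G"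
  then obtain v where v: "v \<in> verts G" "A = component_of G v" unfolding components_def by blast
  have "A \<subseteq> block P v"
  proof
    fix w assume "w \<in> A"
    then have r: "v \<rightarrow>\<^sup>*\<^bsub>with_proj (mk_symmetric G)\<^esub> w" using v component_of_eq by simp
    then have "(v, w) \<in> (parcs (mk_symmetric G))\<^sup>*"
      using S.reachable_conv' by auto
    then have "block P v = block P w"
      by (induction rule: rtrancl_induct) (auto dest: step)
    moreover have "w \<in> verts G" using r S.reachable_in_verts by auto
    ultimately show "w \<in> block P v" using block_in[OF P] by simp
  qed
  then show "\<exists>B\<in>P. A \<subseteq> B" using block_in[OF P v(1)] by blast
qed

end

text \<open>A proper refinement has more blocks.\<close>

lemma card_refines:
  assumes "finite V" "refines V Q P" "P \<noteq> Q"
  shows "card P < card Q"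
proof -
  have Q: "partition_on V Q" and P: "partition_on V P" and sub: "\<And>X. X \<in> Q \<Longrightarrow> \<exists>Y\<in>P. X \<subseteq> Y"
    using assms(2) by (auto simp: refines_def)
  have fin: "finite P" "finite Q" using finite_elements[OF assms(1)] P Q by auto
  define f where "f X = (SOME Y. Y \<in> P \<and> X \<subseteq> Y)" for X
  have f: "f X \<in> P" "X \<subseteq> f X" if "X \<in> Q" for X
  proof -
    have "\<exists>Y. Y \<in> P \<and> X \<subseteq> Y" using sub[OF that] by blast
    then have "f X \<in> P \<and> X \<subseteq> f X" unfolding f_def by (rule someI_ex)
    then show "f X \<in> P" "X \<subseteq> f X" by simp_all
  qed
  have mem: "Y = f X" if "Y \<in> P" "X \<in> Q" "v \<in> X" "v \<in> Y" for X Y v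
    using f[OF that(2)] that P unfolding partition_on_def disjoint_def by blast
  have surj: "f ` Q = P"
  proof (intro equalityI subsetI)
    fix Y assume Y: "Y \<in> P"
    then obtain v where v: "v \<in> Y" using P by (metis ex_in_conv partition_onD3)
    then have "v \<in> V" using Y partition_onD1[OF P] by blast
    then obtain X where "X \<in> Q" "v \<in> X" using partition_onD1[OF Q] by blast
    then show "Y \<in> f ` Q" using mem[OF Y _ _ v] by blast
  qed (use f in blast)
  have "card P \<le> card Q" using card_image_le[OF fin(2), of f] surj by simp
  moreover have "card P \<noteq> card Q"
  proof
    assume eq: "card P = card Q"
    have inj: "inj_on f Q" using surj eq fin by (metis eq_card_imp_inj_on)
    have "f X = X" if X: "X \<in> Q" for X
    proof (intro equalityI f(2)[OF X] subsetI)
      fix v assume v: "v \<in> f X"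
      then have "v \<in> V" using f(1)[OF X] partition_onD1[OF P] by blast
      then obtain X' where X': "X' \<in> Q" "v \<in> X'" using partition_onD1[OF Q] by blast
      then have "f X' = f X" using mem[OF f(1)[OF X] X' v] by simp
      then show "v \<in> X" using inj X X' by (auto dest: inj_onD)
    qed
    then have "P = Q" using surj by force
    then show False using assms(3) by simp
  qed
  ultimately show ?thesis by simp
qed

lemma (in wf_digraph) linear_extensions_eq: "linear_extensions G = lin_exts (verts G) (arc_rel G (arcs G))"
proof -
  have "induced_order G \<subseteq> R \<longleftrightarrow> arc_rel G (arcs G) \<subseteq> R" if R: "linear_order_on (verts G) R" for R
  proof
    assume "induced_order G \<subseteq> R"
    moreover have "arc_rel G (arcs G) \<subseteq> induced_order G"
      unfolding arc_rel_def induced_order_def using in_arcs_imp_in_arcs_ends by auto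
    ultimately show "arc_rel G (arcs G) \<subseteq> R" by blast
  next
    assume sub: "arc_rel G (arcs G) \<subseteq> R"
    have "(v, u) \<in> R" if uv: "u \<rightarrow>\<^sup>* v" for u v
      using uv
    proof (induction rule: reachable_induct)
      case base
      then show ?case using R by (auto simp: order_on_defs refl_on_def)
    next
      case (step x y)
      then have "(y, x) \<in> R" using sub by (auto simp: arc_rel_def arcs_ends_conv)
      then show ?case using step.IH R unfolding order_on_defs by (meson transD)
    qed
    then show "induced_order G \<subseteq> R" unfolding induced_order_def by auto
  qed
  then show ?thesis unfolding linear_extensions_def lin_exts_def by blast
qed

text \<open>
  The case distinction on acyclicity is not needed for a loop-free quiver: if it has a cycle, it has
  no linear extension.
\<close>

lemma (in wf_digraph) e_zero_eq_order_volume: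
  assumes noloop: "\<And>\<epsilon>. \<epsilon> \<in> arcs G \<Longrightarrow> tail G \<epsilon> \<noteq> head G \<epsilon>"
  shows "e_zero G = (order_volume (verts G) (arc_rel G (arcs G)) :: 'k::field_char_0)"
proof -
  have "lin_exts (verts G) (arc_rel G (arcs G)) = {}" if cyc: "\<not> acyclic_quiver G"
  proof (rule ccontr)
    assume "lin_exts (verts G) (arc_rel G (arcs G)) \<noteq> {}"
    then obtain R where R: "linear_order_on (verts G) R" "induced_order G \<subseteq> R"
      unfolding linear_extensions_eq[symmetric] linear_extensions_def by blast
    obtain p where "cycle p" using cyc unfolding acyclic_quiver_def by blast
    then obtain u where u: "awalk u p u" "p \<noteq> []" unfolding cycle_def by blast
    then obtain \<epsilon> q where p: "p = \<epsilon> # q" by (cases p) auto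
    then have e: "\<epsilon> \<in> arcs G" "u = tail G \<epsilon>" and q: "awalk (head G \<epsilon>) q u"
      using u by (auto simp: awalk_Cons_iff)
    have "(u, head G \<epsilon>) \<in> R"
      using reachable_awalkI[OF q] R(2) by (auto simp: induced_order_def)
    moreover have "tail G \<epsilon> \<rightarrow>\<^sup>* head G \<epsilon>" using e(1) using in_arcs_imp_in_arcs_ends by blast
    then have "(head G \<epsilon>, u) \<in> R" using R(2) e(2) by (auto simp: induced_order_def)
    ultimately have "head G \<epsilon> = u" using R(1) by (auto simp: order_on_defs dest: antisymD)
    then show False using noloop[OF e(1)] e(2) by simp
  qed
  then show ?thesis unfolding e_zero_def order_volume_def linear_extensions_eq by auto
qed

section \<open>A closed formula for \<open>\<omega>\<close>\<close>

lemma const_0: "const 0 = (0 :: ('e, 'k::field_char_0) beta_poly)"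
  by (simp add: const_def)

lemma const_1: "const 1 = (1 :: ('e, 'k::field_char_0) beta_poly)"
  by (simp add: const_def)

lemma const_add: "const (a + b) = (const a + const b :: ('e, 'k::field_char_0) beta_poly)"
  by (simp add: const_def Poly_Mapping.single_add)

lemma const_mult: "const (a * b) = (const a * const b :: ('e, 'k::field_char_0) beta_poly)"
  by (simp add: const_def Poly_Mapping.mult_single)

lemma const_sum: "const (\<Sum>x\<in>A. f x) = (\<Sum>x\<in>A. const (f x) :: ('e, 'k::field_char_0) beta_poly)"
  by (induction A rule: infinite_finite_induct) (simp_all add: const_0 const_add)

lemma beta_plus_eq: "beta_plus \<epsilon> = (1 + beta_minus \<epsilon> :: ('e, 'k::field_char_0) beta_poly)"
proof -
  have "const (1 / 2) + const (1 / 2) = (1 :: ('e, 'k) beta_poly)"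
    by (simp add: const_1 flip: const_add)
  then show ?thesis unfolding beta_plus_def beta_minus_def by (simp add: algebra_simps)
qed

text \<open>
  Moebius inversion over the subsets of \<open>I\<close>: the weights \<open>b\<close> and \<open>- b\<close> cancel on every element of
  \<open>I - T\<close>.
\<close>

lemma sum_subset_inversion:
  fixes b :: "'e \<Rightarrow> 'r::comm_ring_1"
  assumes I: "finite I"
  shows "(\<Sum>S\<in>Pow I. (\<Sum>T\<in>Pow S. (\<Prod>\<epsilon>\<in>S - T. b \<epsilon>) * c T) * (\<Prod>\<epsilon>\<in>I - S. - b \<epsilon>)) = c I"
proof -
  have fin: "finite (Pow X)" if "X \<subseteq> I" for X using finite_subset[OF that I] by simp
  have "(\<Sum>S\<in>Pow I. (\<Sum>T\<in>Pow S. (\<Prod>\<epsilon>\<in>S - T. b \<epsilon>) * c T) * (\<Prod>\<epsilon>\<in>I - S. - b \<epsilon>)) =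
      (\<Sum>S\<in>Pow I. \<Sum>T\<in>{T \<in> Pow I. T \<subseteq> S}. (\<Prod>\<epsilon>\<in>S - T. b \<epsilon>) * c T * (\<Prod>\<epsilon>\<in>I - S. - b \<epsilon>))"
    unfolding sum_distrib_right by (intro sum.cong) auto
  also have "\<dots> = (\<Sum>T\<in>Pow I. \<Sum>S\<in>{S \<in> Pow I. T \<subseteq> S}. (\<Prod>\<epsilon>\<in>S - T. b \<epsilon>) * c T * (\<Prod>\<epsilon>\<in>I - S. - b \<epsilon>))"
    using fin by (intro sum.swap_restrict) auto
  also have "\<dots> = (\<Sum>T\<in>Pow I. if T = I then c T else 0)"
  proof (rule sum.cong[OF refl])
    fix T assume T: "T \<in> Pow I"
    have "(\<Sum>S\<in>{S \<in> Pow I. T \<subseteq> S}. (\<Prod>\<epsilon>\<in>S - T. b \<epsilon>) * c T * (\<Prod>\<epsilon>\<in>I - S. - b \<epsilon>)) =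
        (\<Sum>X\<in>Pow (I - T). c T * ((\<Prod>\<epsilon>\<in>X. b \<epsilon>) * (\<Prod>\<epsilon>\<in>(I - T) - X. - b \<epsilon>)))"
    proof (rule sum.reindex_bij_witness[of _ "\<lambda>X. T \<union> X" "\<lambda>S. S - T"])
      fix S assume "S \<in> {S \<in> Pow I. T \<subseteq> S}"
      then have "I - T - (S - T) = I - S" by auto
      then show "c T * ((\<Prod>\<epsilon>\<in>S - T. b \<epsilon>) * (\<Prod>\<epsilon>\<in>I - T - (S - T). - b \<epsilon>)) =
          (\<Prod>\<epsilon>\<in>S - T. b \<epsilon>) * c T * (\<Prod>\<epsilon>\<in>I - S. - b \<epsilon>)" by (simp add: mult_ac)
    qed (use T in auto)
    also have "\<dots> = c T * (\<Prod>\<epsilon>\<in>I - T. b \<epsilon> + - b \<epsilon>)"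
      unfolding sum_distrib_left[symmetric] by (subst prod_add) (use I in auto)
    also have "\<dots> = (if T = I then c T else 0)"
    proof (cases "T = I")
      case False
      then have "card (I - T) \<noteq> 0" using T I by (auto simp: card_eq_0_iff)
      then show ?thesis using False by (simp add: power_0_left)
    qed simp
    finally show "(\<Sum>S\<in>{S \<in> Pow I. T \<subseteq> S}. (\<Prod>\<epsilon>\<in>S - T. b \<epsilon>) * c T * (\<Prod>\<epsilon>\<in>I - S. - b \<epsilon>)) =
        (if T = I then c T else 0)" .
  qed
  also have "\<dots> = c I" using fin[of I] by (simp add: sum.delta)
  finally show ?thesis .
qed

text \<open>
  The coefficient of \<open>N\<^sup>k\<close> in \<open>\<Sum>\<^sub>f \<Prod>\<^bsub>\<epsilon> \<in> S\<^esub> w\<^sub>\<epsilon>(f)\<close>, where \<open>f\<close> runs over the maps from the vertices to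
  \<open>{0, \<dots>, N - 1}\<close> and \<open>w\<^sub>\<epsilon>(f)\<close> is \<open>\<beta>\<^bsub>\<epsilon>,+\<^esub>\<close> if \<open>f\<close> is strictly smaller at the head of \<open>\<epsilon>\<close> than at its
  tail, and \<open>\<beta>\<^bsub>\<epsilon>,-\<^esub>\<close> otherwise. Since \<open>\<beta>\<^bsub>\<epsilon>,+\<^esub> = \<beta>\<^bsub>\<epsilon>,-\<^esub> + 1\<close>, expanding the product over the set \<open>T\<close> of
  arcs that contribute the \<open>1\<close> leaves order polynomials with coefficients in the field.
\<close>

definition arc_weight :: "('v, 'e) pre_digraph \<Rightarrow> 'e set \<Rightarrow> nat \<Rightarrow> ('e, 'k::field_char_0) beta_poly" where
  "arc_weight G S k = (\<Sum>T\<in>Pow S. (\<Prod>\<epsilon>\<in>S - T. beta_minus \<epsilon>) * const (coeff (order_poly (verts G) (arc_rel G T)) k))"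

text \<open>
  The lowest coefficient that can be nonzero, since the sum above is divisible by \<open>N\<close> to the number
  of components. The value outside finite quivers is the one prescribed for \<open>\<omega>\<close>.
\<close>

definition omega_formula :: "('v, 'e) pre_digraph \<Rightarrow> ('e, 'k::field_char_0) beta_poly" where
  "omega_formula H = (if fin_digraph H then arc_weight H (arcs H) (card (components H)) else 0)"

text \<open>
  The arcs with both ends in one block of \<open>P\<close>. If \<open>P\<close> consists of the components of a cut-subquiver
  \<open>H\<close>, those outside \<open>H\<close> are the loops of the contraction.
\<close>

definition internal_arcs :: "('v, 'e) pre_digraph \<Rightarrow> 'v set set \<Rightarrow> 'e set" where
  "internal_arcs G P = {\<epsilon> \<in> arcs G. (head G \<epsilon>, tail G \<epsilon>) \<in> internal P}"

text \<open>
  A partition with no arc between different blocks, other than the partition into components, has too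
  few blocks for the coefficient to be nonzero.
\<close>

lemma arc_weight_eq_0:
  assumes H: "fin_digraph H" and P: "partition_on (verts H) P" "arc_rel H (arcs H) \<subseteq> internal P"
    and ne: "P \<noteq> components H"
  shows "arc_weight H (arcs H) (card P) = (0 :: ('e, 'k::field_char_0) beta_poly)"
proof -
  interpret fin_digraph H by fact
  have lt: "card P < card (components H)"
    using card_refines[OF finite_verts refines_components[OF P] ne] .
  have "coeff (order_poly (verts H) (arc_rel H T)) (card P) = (0 :: 'k)" if "T \<subseteq> arcs H" for T
  proof -
    have "arc_rel H T \<subseteq> internal (components H)"
      using that component_of_tail_head internal_iff[OF partition_on_components] block_components
      unfolding arc_rel_def by auto
    then have "monom 1 (card (components H)) dvd (order_poly (verts H) (arc_rel H T) :: 'k poly)"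
      by (rule monom_dvd_order_poly[OF finite_verts partition_on_components])
    then obtain q where "order_poly (verts H) (arc_rel H T) = (monom 1 (card (components H)) * q :: 'k poly)"
      by blast
    then show ?thesis using lt by (simp add: coeff_monom_mult)
  qed
  then show ?thesis unfolding arc_weight_def by (simp add: const_0)
qed

lemma spanningD:
  assumes "spanning H G"
  shows "verts H = verts G" "arcs H \<subseteq> arcs G" "tail H = tail G" "head H = head G" "wf_digraph H"
  using assms by (auto simp: spanning_def subgraph_def compatible_def)

lemma e_fun_contract:
  assumes G: "fin_digraph G" and H: "spanning H G"
  shows "e_fun (contract G H) = ((\<Prod>\<epsilon>\<in>internal_arcs G (components H) - arcs H. - beta_minus \<epsilon>) *
    const (order_volume (components H) (quotient_rel (components H) (arc_rel G (arcs G)))) :: ('e, 'k::field_char_0) beta_poly)"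
proof -
  interpret G: fin_digraph G by fact
  interpret H: wf_digraph H using spanningD[OF H] by simp
  let ?P = "components H" and ?K = "pruned (contract G H)"
  have v: "verts H = verts G" using spanningD[OF H] by simp
  have blk: "component_of H (tail G \<epsilon>) = block ?P (tail G \<epsilon>)" "component_of H (head G \<epsilon>) = block ?P (head G \<epsilon>)"
    if "\<epsilon> \<in> arcs G" for \<epsilon>
    using that H.block_components v by simp_all
  have P: "partition_on (verts G) ?P" using H.partition_on_components v by simp
  have int: "\<epsilon> \<in> internal_arcs G ?P \<longleftrightarrow> component_of H (tail G \<epsilon>) = component_of H (head G \<epsilon>)"
    if "\<epsilon> \<in> arcs G" for \<epsilon>
    using that internal_iff[OF P, of "head G \<epsilon>" "tail G \<epsilon>"] blk unfolding internal_arcs_def by auto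
  have HI: "arcs H \<subseteq> internal_arcs G ?P"
    using H.component_of_tail_head spanningD[OF H] int by auto
  have tad: "tadpoles (contract G H) = internal_arcs G ?P - arcs H"
    using int unfolding tadpoles_def contract_def by (auto simp: internal_arcs_def)
  have arcs: "arcs ?K = arcs G - internal_arcs G ?P"
    using HI spanningD[OF H] unfolding pruned_def tad by (auto simp: contract_def)
  have ht: "head ?K \<epsilon> = component_of H (head G \<epsilon>)" "tail ?K \<epsilon> = component_of H (tail G \<epsilon>)" "verts ?K = ?P" for \<epsilon>
    by (simp_all add: pruned_def contract_def components_def)
  interpret K: wf_digraph ?K
    by unfold_locales (auto simp: arcs ht components_def v)
  have "arc_rel ?K (arcs ?K) = quotient_rel ?P (arc_rel G (arcs G))"
    using blk unfolding arc_rel_def quotient_rel_def ht arcs internal_arcs_def by force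
  moreover have "e_zero ?K = (order_volume (verts ?K) (arc_rel ?K (arcs ?K)) :: 'k)"
    by (rule K.e_zero_eq_order_volume) (use int in \<open>auto simp: arcs ht\<close>)
  ultimately show ?thesis unfolding e_fun_def tad by (simp add: ht)
qed

text \<open>
  By the preceding vanishing, the sum over the cut-subquivers \<open>H\<close> may be enlarged to a sum over all
  pairs of \<open>H\<close> and a partition \<open>P\<close> such that every arc of \<open>H\<close> is internal to \<open>P\<close>. For a fixed \<open>P\<close>, the
  weights \<open>\<beta>\<^bsub>\<epsilon>,-\<^esub>\<close> of \<open>H\<close> and \<open>-\<beta>\<^bsub>\<epsilon>,-\<^esub>\<close> of the loops cancel, and what remains is the inversion formula
  for order polynomials.
\<close>

lemma sum_omega_formula:
  assumes G: "fin_digraph G"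
  shows "(\<Sum>H | spanning H G. omega_formula H * e_fun (contract G H)) = (eps_fun G :: ('e, 'k::field_char_0) beta_poly)"
proof -
  interpret G: fin_digraph G by fact
  let ?V = "verts G" and ?E = "arcs G"
  define vol where "vol P = (const (order_volume P (quotient_rel P (arc_rel G ?E))) :: ('e, 'k) beta_poly)" for P
  define I where "I = internal_arcs G"
  define t where "t P S = (arc_weight G S (card P) * (\<Prod>\<epsilon>\<in>I P - S. - beta_minus \<epsilon>) :: ('e, 'k) beta_poly)" for P S
  have finP: "finite {P. partition_on ?V P}" by (rule finitely_many_partition_on) simp
  have I_sub: "I P \<subseteq> ?E" for P unfolding I_def internal_arcs_def by auto
  have "omega_formula H * e_fun (contract G H) =
      (\<Sum>P | partition_on ?V P. if arcs H \<subseteq> I P then t P (arcs H) * vol P else 0)"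
    if H: "spanning H G" for H
  proof -
    have finH: "fin_digraph H" by (rule spanning_fin_digraph[OF G H])
    interpret H: fin_digraph H by (rule finH)
    note D = spanningD[OF H]
    have w: "arc_weight H = (arc_weight G :: _ \<Rightarrow> _ \<Rightarrow> ('e, 'k) beta_poly)"
      unfolding arc_weight_def[abs_def] arc_rel_def[abs_def] D ..
    have sub_iff: "arcs H \<subseteq> I P \<longleftrightarrow> arc_rel H (arcs H) \<subseteq> internal P" for P
      using D unfolding I_def internal_arcs_def arc_rel_def by auto
    have PH: "partition_on ?V (components H)" using H.partition_on_components D by simp
    have subH: "arcs H \<subseteq> I (components H)"
      unfolding sub_iff using H.component_of_tail_head internal_iff[OF H.partition_on_components] H.block_components
      by (auto simp: arc_rel_def)
    have "(if arcs H \<subseteq> I P then t P (arcs H) * vol P else 0) =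
        (if P = components H then omega_formula H * e_fun (contract G H) else 0)"
      if P: "partition_on ?V P" for P
    proof (cases "P = components H")
      case True
      then show ?thesis
        using subH by (simp add: t_def vol_def omega_formula_def finH w e_fun_contract[OF G H] I_def mult.assoc)
    next
      case False
      then show ?thesis
        using arc_weight_eq_0[OF finH _ _ False, where 'k = 'k] P D(1) sub_iff by (auto simp: t_def w)
    qed
    then have "(\<Sum>P | partition_on ?V P. if arcs H \<subseteq> I P then t P (arcs H) * vol P else 0) =
        (\<Sum>P | partition_on ?V P. if P = components H then omega_formula H * e_fun (contract G H) else 0)"
      by (intro sum.cong) auto
    then show ?thesis using finP PH by (simp add: sum.delta)
  qed
  then have "(\<Sum>H | spanning H G. omega_formula H * e_fun (contract G H)) =
      (\<Sum>H | spanning H G. \<Sum>P | partition_on ?V P. if arcs H \<subseteq> I P then t P (arcs H) * vol P else 0)"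
    by (intro sum.cong) auto
  also have "\<dots> = (\<Sum>P | partition_on ?V P. \<Sum>H | spanning H G. if arcs H \<subseteq> I P then t P (arcs H) * vol P else 0)"
    by (rule sum.swap)
  also have "\<dots> = (\<Sum>P | partition_on ?V P. const (coeff (order_poly ?V (arc_rel G ?E \<inter> internal P)) (card P)) * vol P)"
  proof (rule sum.cong[OF refl])
    fix P
    have "(\<Sum>H | spanning H G. if arcs H \<subseteq> I P then t P (arcs H) * vol P else 0) =
        (\<Sum>S\<in>Pow ?E. if S \<subseteq> I P then t P S * vol P else 0)"
    proof (rule sum.reindex_bij_witness[of _ "\<lambda>S. G\<lparr>arcs := S\<rparr>" arcs])
      fix S assume "S \<in> Pow ?E"
      then have S: "S \<subseteq> ?E" by simp
      have "wf_digraph (G\<lparr>arcs := S\<rparr>)" using S by unfold_locales auto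
      then show "G\<lparr>arcs := S\<rparr> \<in> {H. spanning H G}"
        using S G.wf_digraph_axioms by (simp add: spanning_def subgraph_def compatible_def)
    qed (auto simp: spanning_def subgraph_def compatible_def)
    also have "\<dots> = (\<Sum>S\<in>Pow (I P). t P S * vol P)"
      using I_sub by (intro sum.mono_neutral_cong_right) auto
    also have "\<dots> = const (coeff (order_poly ?V (arc_rel G (I P))) (card P)) * vol P"
      unfolding t_def arc_weight_def sum_distrib_right[symmetric]
      by (subst sum_subset_inversion) (use I_sub[of P] in \<open>auto intro: finite_subset\<close>)
    also have "arc_rel G (I P) = arc_rel G ?E \<inter> internal P"
      unfolding arc_rel_def I_def internal_arcs_def by auto
    finally show "(\<Sum>H | spanning H G. if arcs H \<subseteq> I P then t P (arcs H) * vol P else 0) =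
        const (coeff (order_poly ?V (arc_rel G ?E \<inter> internal P)) (card P)) * vol P" .
  qed
  also have "\<dots> = const (\<Sum>P | partition_on ?V P. order_volume P (quotient_rel P (arc_rel G ?E)) *
      coeff (order_poly ?V (arc_rel G ?E \<inter> internal P)) (card P))"
    by (simp add: const_sum const_mult vol_def mult.commute)
  also have "\<dots> = const (if arc_rel G ?E = {} then 1 else 0)"
    by (subst sum_order_volume_coeff) (auto simp: arc_rel_def)
  also have "\<dots> = eps_fun G"
    by (auto simp: eps_fun_def arc_rel_def const_0 const_1)
  finally show ?thesis .
qed

theorem omega_eq: "omega = (omega_formula :: ('v, 'e) pre_digraph \<Rightarrow> ('e, 'k::field_char_0) beta_poly)"
proof (rule omega_spec_unique[OF omega_spec_omega])
  show "omega_spec (omega_formula :: ('v, 'e) pre_digraph \<Rightarrow> ('e, 'k) beta_poly)"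
    unfolding omega_spec_def by (intro conjI allI impI sum_omega_formula) (simp_all add: omega_formula_def)
qed

lemma (in wf_digraph) connected_iff_components:
  assumes "verts G \<noteq> {}"
  shows "connected G \<longleftrightarrow> components G = {verts G}"
proof -
  interpret S: pair_wf_digraph "mk_symmetric G" ..
  have "connected G \<longleftrightarrow> (\<forall>v\<in>verts G. component_of G v = verts G)"
    using assms component_of_subset unfolding connected_def strongly_connected_def component_of_eq by auto
  also have "\<dots> \<longleftrightarrow> components G = {verts G}"
    using assms unfolding components_def by auto
  finally show ?thesis .
qed

text \<open>
  The formula for connected quivers also covers the disconnected ones, where the linear coefficient
  vanishes.
\<close>

theorem omega_c_eq:
  fixes G :: "('v, 'e) pre_digraph"
  assumes G: "fin_digraph G" and ne: "verts G \<noteq> {}"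
  shows "omega_c G = (arc_weight G (arcs G) 1 :: ('e, 'k::field_char_0) beta_poly)"
proof -
  interpret fin_digraph G by fact
  show ?thesis
  proof (cases "connected G")
    case True
    then have "card (components G) = 1" using connected_iff_components[OF ne] by simp
    then show ?thesis using True G by (simp add: omega_c_def omega_eq omega_formula_def)
  next
    case False
    have P: "partition_on (verts G) {verts G}" using ne by (rule partition_on_space)
    have "arc_weight G (arcs G) (card {verts G}) = (0 :: ('e, 'k) beta_poly)"
      by (rule arc_weight_eq_0[OF G P])
        (use False connected_iff_components[OF ne] in \<open>auto simp: arc_rel_def internal_def\<close>)
    then show ?thesis using False by (simp add: omega_c_def)
  qed
qed


section \<open>The expansion over permutations\<close>

theorem theorem6p7:
  fixes G :: "(nat, 'e) pre_digraph" and n :: nat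
  assumes "fin_digraph G"
    and "acyclic_quiver G"
    and "n \<ge> 1"
    and "verts G = {1..n}"
    and "\<And>\<epsilon>. \<epsilon> \<in> arcs G \<Longrightarrow> head G \<epsilon> < tail G \<epsilon>"
  shows "(omega_c G :: ('e, 'k::field_char_0) beta_poly) =
    (\<Sum>\<sigma> | \<sigma> permutes {1..n}.
       const (d_coeff n (descents n \<sigma>)) * (\<Prod>\<epsilon>\<in>arcs G. beta_sign G \<sigma> \<epsilon>))"
proof -
  interpret fin_digraph G by fact
  let ?S = "{\<sigma>. \<sigma> permutes {1..n}}"
  define up where "up \<sigma> \<epsilon> \<longleftrightarrow> inv \<sigma> (head G \<epsilon>) < inv \<sigma> (tail G \<epsilon>)" for \<sigma> :: "nat \<Rightarrow> nat" and \<epsilon>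
  define d where "d \<sigma> = (const (d_coeff n (descents n \<sigma>)) :: ('e, 'k) beta_poly)" for \<sigma>
  have finS: "finite ?S" by (rule finite_permutations) simp
  have coeff: "const (coeff (order_poly (verts G) (arc_rel G T)) 1) =
      (\<Sum>\<sigma>\<in>?S. d \<sigma> * (\<Prod>\<epsilon>\<in>T. if up \<sigma> \<epsilon> then 1 else 0))" if T: "T \<subseteq> arcs G" for T
  proof -
    have finT: "finite T" using T finite_arcs by (rule finite_subset)
    have R: "arc_rel G T \<subseteq> {1..n} \<times> {1..n}"
      using T assms(4) head_in_verts tail_in_verts unfolding arc_rel_def by blast
    have lt: "a < b" if "(a, b) \<in> arc_rel G T" for a b
      using that T assms(5) unfolding arc_rel_def by auto
    have "(\<forall>(a, b)\<in>arc_rel G T. inv \<sigma> a < inv \<sigma> b) \<longleftrightarrow> (\<forall>\<epsilon>\<in>T. up \<sigma> \<epsilon>)" for \<sigma> :: "nat \<Rightarrow> nat"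
      unfolding arc_rel_def up_def by auto
    then have "const (coeff (order_poly (verts G) (arc_rel G T)) 1) = (\<Sum>\<sigma> | \<sigma> permutes {1..n} \<and> (\<forall>\<epsilon>\<in>T. up \<sigma> \<epsilon>). d \<sigma>)"
      using coeff_1_order_poly_labelled[OF assms(3) R lt, where 'k = 'k] unfolding assms(4) d_def
      by (simp add: const_sum)
    also have "\<dots> = (\<Sum>\<sigma>\<in>?S. if \<forall>\<epsilon>\<in>T. up \<sigma> \<epsilon> then d \<sigma> else 0)"
      using finS by (intro sum.mono_neutral_cong_left) auto
    also have "\<dots> = (\<Sum>\<sigma>\<in>?S. d \<sigma> * (\<Prod>\<epsilon>\<in>T. if up \<sigma> \<epsilon> then 1 else 0))"
    proof (rule sum.cong[OF refl])
      fix \<sigma>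
      show "(if \<forall>\<epsilon>\<in>T. up \<sigma> \<epsilon> then d \<sigma> else 0) = d \<sigma> * (\<Prod>\<epsilon>\<in>T. if up \<sigma> \<epsilon> then 1 else 0)"
      proof (cases "\<forall>\<epsilon>\<in>T. up \<sigma> \<epsilon>")
        case False
        then have "(\<Prod>\<epsilon>\<in>T. if up \<sigma> \<epsilon> then 1 else 0) = (0 :: ('e, 'k) beta_poly)"
          by (intro prod_zero[OF finT]) auto
        then show ?thesis by (simp only: False if_False mult_zero_right)
      qed simp
    qed
    finally show ?thesis .
  qed
  have "omega_c G = (arc_weight G (arcs G) 1 :: ('e, 'k) beta_poly)"
    by (rule omega_c_eq) (use assms in auto)
  also have "\<dots> = (\<Sum>T\<in>Pow (arcs G). \<Sum>\<sigma>\<in>?S.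
      d \<sigma> * ((\<Prod>\<epsilon>\<in>T. if up \<sigma> \<epsilon> then 1 else 0) * (\<Prod>\<epsilon>\<in>arcs G - T. beta_minus \<epsilon>)))"
    unfolding arc_weight_def
  proof (rule sum.cong[OF refl])
    fix T assume "T \<in> Pow (arcs G)"
    then have T: "T \<subseteq> arcs G" by simp
    show "(\<Prod>\<epsilon>\<in>arcs G - T. beta_minus \<epsilon>) * const (coeff (order_poly (verts G) (arc_rel G T)) 1) =
      (\<Sum>\<sigma>\<in>?S. d \<sigma> * ((\<Prod>\<epsilon>\<in>T. if up \<sigma> \<epsilon> then 1 else 0) * (\<Prod>\<epsilon>\<in>arcs G - T. beta_minus \<epsilon>)))"
      unfolding coeff[OF T] by (simp add: sum_distrib_left mult_ac)
  qed
  also have "\<dots> = (\<Sum>\<sigma>\<in>?S. \<Sum>T\<in>Pow (arcs G).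
      d \<sigma> * ((\<Prod>\<epsilon>\<in>T. if up \<sigma> \<epsilon> then 1 else 0) * (\<Prod>\<epsilon>\<in>arcs G - T. beta_minus \<epsilon>)))"
    by (rule sum.swap)
  also have "\<dots> = (\<Sum>\<sigma>\<in>?S. d \<sigma> * (\<Prod>\<epsilon>\<in>arcs G. (if up \<sigma> \<epsilon> then 1 else 0) + beta_minus \<epsilon>))"
    by (simp add: prod_add flip: sum_distrib_left)
  \<comment> \<open>Each factor is \<open>\<beta>\<^bsub>\<epsilon>,+\<^esub> = 1 + \<beta>\<^bsub>\<epsilon>,-\<^esub>\<close> or \<open>\<beta>\<^bsub>\<epsilon>,-\<^esub>\<close>.\<close>
  also have "\<dots> = (\<Sum>\<sigma>\<in>?S. d \<sigma> * (\<Prod>\<epsilon>\<in>arcs G. beta_sign G \<sigma> \<epsilon>))"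
    by (intro sum.cong refl arg_cong2[where f = "(*)"] prod.cong)
      (simp_all add: beta_sign_def up_def beta_plus_eq)
  finally show ?thesis by (simp add: d_def)
qed

end
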